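(* Let $\mathcal L$ be a finite distributive lattice, $\mathcal I$ a poset ideal and $\mathcal J$ a poset coideal of $\mathcal L$. If $\mathcal I\cup\mathcal J=\mathcal L$ and $\mathcal I\cap\mathcal J=\emptyset$, then the ideal $H_{\mathcal I}\cap H_{\mathcal J}$ has a linear resolution.
   Context: Let $P$ be the set of join-irreducible elements of $\mathcal L$ (elements with exactly one lower neighbor), with the induced order; for $p\in\mathcal L$ put $\ell(p)=\{q\in P:q\le p\}$. Let $K$ be a field and $S=K[x_p,y_p: p\in P]$ with all variables of degree 1. For $q\in\mathcal L$ put $u_q=\prod_{p\in\ell(q)}x_p\prod_{p\in P\setminus\ell(q)}y_p$, and for $\mathcal S\subseteq\mathcal L$ let $H_{\mathcal S}$ be the ideal generated by $\{u_q:q\in\mathcal S\}$. Poset ideals are closed downward, poset coideals upward. A graded ideal has a linear resolution if all its minimal generators have the same degree $d$ and in its graded minimal free resolution the $i$-th module is generated in degree $d+i$ for all $i$. *)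

theory Defs
  imports Main "HOL-Library.Poly_Mapping"
begin

definition covers :: "'a::order \<Rightarrow> 'a \<Rightarrow> bool" where
  "covers q p \<longleftrightarrow> q < p \<and> \<not> (\<exists>r. q < r \<and> r < p)"

definition join_irred :: "'a::order \<Rightarrow> bool" where
  "join_irred p \<longleftrightarrow> (\<exists>!q. covers q p)"

definition JI :: "'a::order set" where
  "JI = {p. join_irred p}"

definition lowset :: "'a::order \<Rightarrow> 'a set" where
  "lowset p = {q \<in> JI. q \<le> p}"

definition poset_ideal :: "'a::order set \<Rightarrow> bool" where
  "poset_ideal I \<longleftrightarrow> (\<forall>x\<in>I. \<forall>y. y \<le> x \<longrightarrow> y \<in> I)"

definition poset_coideal :: "'a::order set \<Rightarrow> bool" where
  "poset_coideal J \<longleftrightarrow> (\<forall>x\<in>J. \<forall>y. x \<le> y \<longrightarrow> y \<in> J)"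

type_synonym ('v, 'k) mpoly = "('v \<Rightarrow>\<^sub>0 nat) \<Rightarrow>\<^sub>0 'k"

definition Var :: "'v \<Rightarrow> ('v, 'k::comm_ring_1) mpoly" where
  "Var v = Poly_Mapping.single (Poly_Mapping.single v 1) 1"

definition mdeg :: "('v \<Rightarrow>\<^sub>0 nat) \<Rightarrow> nat" where
  "mdeg m = (\<Sum>v\<in>Poly_Mapping.keys m. Poly_Mapping.lookup m v)"

text \<open>homogeneous of degree k (the zero polynomial is homogeneous of every degree)\<close>
definition homog :: "nat \<Rightarrow> ('v, 'k::comm_ring_1) mpoly \<Rightarrow> bool" where
  "homog k f \<longleftrightarrow> (\<forall>m\<in>Poly_Mapping.keys f. mdeg m = k)"

definition polyring :: "'v set \<Rightarrow> ('v, 'k::comm_ring_1) mpoly set" where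
  "polyring V = {f. \<forall>m\<in>Poly_Mapping.keys f. Poly_Mapping.keys m \<subseteq> V}"

text \<open>Variables: (p, True) is x_p and (p, False) is y_p, for p in JI.\<close>
definition Svars :: "('a::order \<times> bool) set" where
  "Svars = JI \<times> UNIV"

definition u_mon :: "'a::order \<Rightarrow> ('a \<times> bool, 'k::comm_ring_1) mpoly" where
  "u_mon q = (\<Prod>p\<in>lowset q. Var (p, True)) * (\<Prod>p\<in>JI - lowset q. Var (p, False))"

definition H_ideal :: "'a::{order,finite} set \<Rightarrow> ('a \<times> bool, 'k::comm_ring_1) mpoly set" where
  "H_ideal A = {f. \<exists>c. (\<forall>q\<in>A. c q \<in> polyring Svars) \<and> f = (\<Sum>q\<in>A. c q * u_mon q)}"

definition freemod :: "'v set \<Rightarrow> nat \<Rightarrow> (nat \<Rightarrow> ('v, 'k::comm_ring_1) mpoly) set" where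
  "freemod V b = {v. (\<forall>j<b. v j \<in> polyring V) \<and> (\<forall>j\<ge>b. v j = 0)}"

definition matapp :: "nat \<Rightarrow> nat \<Rightarrow> (nat \<Rightarrow> nat \<Rightarrow> ('v, 'k::comm_ring_1) mpoly)
    \<Rightarrow> (nat \<Rightarrow> ('v, 'k) mpoly) \<Rightarrow> (nat \<Rightarrow> ('v, 'k) mpoly)" where
  "matapp r c A v = (\<lambda>i. if i < r then (\<Sum>j<c. A i j * v j) else 0)"

text \<open>
  M (a subset of S = K[V]) has a linear resolution: there is a graded free resolution
  \<dots> \<rightarrow> F_2 \<rightarrow> F_1 \<rightarrow> F_0 \<rightarrow> M \<rightarrow> 0 with F_i = S(-d-i)^(b i), i.e. the augmentation
  F_0 \<rightarrow> M is given by generators g_0..g_(b0-1) homogeneous of degree d, and the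
  map F_(i+1) \<rightarrow> F_i is a (b i) x (b (i+1)) matrix A i of linear forms.
  (The minimal graded free resolution is a direct summand of any graded free resolution,
  so this is equivalent to the minimal resolution being linear.)
\<close>
definition has_linear_resolution :: "'v set \<Rightarrow> ('v, 'k::field) mpoly set \<Rightarrow> bool" where
  "has_linear_resolution V M \<longleftrightarrow>
    (\<exists>(d::nat) (b::nat \<Rightarrow> nat) (g::nat \<Rightarrow> ('v, 'k) mpoly)
        (A::nat \<Rightarrow> nat \<Rightarrow> nat \<Rightarrow> ('v, 'k) mpoly).
       (\<forall>j<b 0. g j \<in> polyring V \<and> homog d (g j)) \<and>
       (\<forall>i r c. r < b i \<and> c < b (Suc i) \<longrightarrow> A i r c \<in> polyring V \<and> homog 1 (A i r c)) \<and>
       M = {(\<Sum>j<b 0. v j * g j) | v. v \<in> freemod V (b 0)} \<and>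
       {v \<in> freemod V (b 0). (\<Sum>j<b 0. v j * g j) = 0}
          = matapp (b 0) (b 1) (A 0) ` freemod V (b 1) \<and>
       (\<forall>i. {v \<in> freemod V (b (Suc i)). matapp (b i) (b (Suc i)) (A i) v = (\<lambda>_. 0)}
          = matapp (b (Suc i)) (b (Suc (Suc i))) (A (Suc i)) ` freemod V (b (Suc (Suc i)))))"

end

(*
  A cell is a Boolean interval of the lattice of down-sets of P: the pair (E, T) stands for the
  interval from E to E \<union> T.  These cells, with labels lcm of the u_D over the interval, form a
  cubical complex whose differential has the entries x_t and - y_t.  The cells inside the ideal \<I>,
  the cells inside the coideal \<J>, and all cells give resolutions of H_\<I>, H_\<J> and H_\<L>: filtered by
  the top (for \<I>) or the bottom (for \<J>) of a cell, the complex has Koszul complexes of variables as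
  its graded pieces.  By 0 \<rightarrow> H_\<I> \<inter> H_\<J> \<rightarrow> H_\<I> \<oplus> H_\<J> \<rightarrow> H_\<L> \<rightarrow> 0, the cells with bottom in \<I> and top
  in \<J>, shifted by one homological degree, then give a resolution of H_\<I> \<inter> H_\<J>, and all its
  matrix entries are linear forms.
*)
theory Submission
  imports Defs
begin

text \<open>What makes the Koszul pieces fit together is a colon condition. For a down-set E let
  M(E) be the set of t outside E for which E \<union> {t} is again a down-set. Any other down-set D
  with at least as many elements as E contains some t of M(E), so u_D lies in the ideal (x_t : t in
  M(E)), while u_E is prime to these variables. Hence a cycle of augmentation zero has its
  coefficient at a vertex E of least size in that ideal. This is the end condition that the Koszul
  complex needs, since its H_0 is R/(x_t) and not 0. The variables and monomials enter through
  axioms that are symmetric under complementation in P, so the filtration by tops costs no second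
  proof. Chains of all dimensions are treated together; the dimensions are separated only after the
  relative complex has been shown exact. The connecting map sends an edge from E in I to E \<union>
  {t} in J to x_t u_E, the lcm of its two vertex labels. Hence the generators have degree |P| +
  1.\<close>

section \<open>Sums and ideals in a subring\<close>

text \<open>This is the cancellation in d d = 0. Exchanging the two indices would give only 2S = 0,
  which is too weak in characteristic 2; the induction removes the pairs (s, t) and (t, s)
  together.\<close>

lemma sum_antisymmetric:
  fixes f :: "'b \<Rightarrow> 'b \<Rightarrow> 'c::ab_group_add"
  assumes "finite A"
    and "\<And>s t. s \<in> A \<Longrightarrow> t \<in> A \<Longrightarrow> s \<noteq> t \<Longrightarrow> f s t + f t s = 0"
  shows "(\<Sum>s\<in>A. \<Sum>t\<in>A - {s}. f s t) = 0"
  using assms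
proof (induction A rule: finite_induct)
  case empty
  then show ?case by simp
next
  case (insert a A)
  have 1: "(\<Sum>t\<in>insert a A - {s}. f s t) = f s a + (\<Sum>t\<in>A - {s}. f s t)" if "s \<in> A" for s
  proof -
    have "insert a A - {s} = insert a (A - {s})" "a \<notin> A - {s}"
      using that insert by auto
    then show ?thesis using insert(1) by simp
  qed
  have "(\<Sum>s\<in>insert a A. \<Sum>t\<in>insert a A - {s}. f s t)
      = (\<Sum>t\<in>A. f a t) + (\<Sum>s\<in>A. f s a + (\<Sum>t\<in>A - {s}. f s t))"
    using insert(1,2) by (simp add: 1)
  also have "\<dots> = (\<Sum>t\<in>A. f a t + f t a) + (\<Sum>s\<in>A. \<Sum>t\<in>A - {s}. f s t)"
    by (simp add: sum.distrib)
  also have "\<dots> = 0"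
    using insert by (auto intro!: sum.neutral)
  finally show ?case .
qed

definition lincomb :: "'r::comm_ring_1 set \<Rightarrow> ('p \<Rightarrow> 'r) \<Rightarrow> 'p set \<Rightarrow> 'r set" where
  "lincomb R x M = {(\<Sum>t\<in>M. c t * x t) | c. \<forall>t. c t \<in> R}"

text \<open>The polynomial ring of the theorem has only the variables indexed by \<open>JI\<close>,
  so it is a subset of its type. This is why rings appear as carriers.\<close>

locale ring_subset =
  fixes R :: "'r::comm_ring_1 set"
  assumes R0 [simp, intro]: "0 \<in> R" and R1 [simp, intro]: "1 \<in> R"
    and Radd [intro]: "f \<in> R \<Longrightarrow> g \<in> R \<Longrightarrow> f + g \<in> R"
    and Rmult [intro]: "f \<in> R \<Longrightarrow> g \<in> R \<Longrightarrow> f * g \<in> R"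
    and Ruminus [intro]: "f \<in> R \<Longrightarrow> - f \<in> R"
begin

lemma Rdiff [intro]: "f \<in> R \<Longrightarrow> g \<in> R \<Longrightarrow> f - g \<in> R"
  using Radd[of f "- g"] Ruminus[of g] by simp

lemma Rsum [intro]: "(\<And>t. t \<in> M \<Longrightarrow> c t \<in> R) \<Longrightarrow> (\<Sum>t\<in>M. c t) \<in> R"
  by (induction M rule: infinite_finite_induct) auto

lemma lincombI:
  assumes "\<And>t. t \<in> M \<Longrightarrow> c t \<in> R"
  shows "(\<Sum>t\<in>M. c t * x t) \<in> lincomb R x M"
proof -
  have "(\<Sum>t\<in>M. c t * x t) = (\<Sum>t\<in>M. (if t \<in> M then c t else 0) * x t)"
    by (intro sum.cong) auto
  moreover have "\<forall>t. (if t \<in> M then c t else 0) \<in> R" using assms by auto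
  ultimately show ?thesis unfolding lincomb_def by (intro CollectI exI conjI)
qed

lemma lincomb_add: "f \<in> lincomb R x M \<Longrightarrow> g \<in> lincomb R x M \<Longrightarrow> f + g \<in> lincomb R x M"
proof -
  assume "f \<in> lincomb R x M" "g \<in> lincomb R x M"
  then obtain c d where "f = (\<Sum>t\<in>M. c t * x t)" "\<forall>t. c t \<in> R" "g = (\<Sum>t\<in>M. d t * x t)" "\<forall>t. d t \<in> R"
    unfolding lincomb_def by blast
  then show ?thesis using lincombI[of M "\<lambda>t. c t + d t" x]
    by (simp add: Radd algebra_simps sum.distrib)
qed

lemma lincomb_mult: "f \<in> lincomb R x M \<Longrightarrow> r \<in> R \<Longrightarrow> r * f \<in> lincomb R x M"
proof -
  assume "f \<in> lincomb R x M" and r: "r \<in> R"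
  then obtain c where "f = (\<Sum>t\<in>M. c t * x t)" "\<forall>t. c t \<in> R"
    unfolding lincomb_def by blast
  then show ?thesis using lincombI[of M "\<lambda>t. r * c t" x] r
    by (simp add: Rmult sum_distrib_left mult.assoc)
qed

lemma lincomb_uminus: "f \<in> lincomb R x M \<Longrightarrow> - f \<in> lincomb R x M"
  using lincomb_mult[of f x M "-1"] by auto

lemma lincomb_0: "0 \<in> lincomb R x M"
  using lincombI[of M "\<lambda>_. 0" x] by simp

lemma lincomb_sum: "(\<And>i. i \<in> A \<Longrightarrow> f i \<in> lincomb R x M) \<Longrightarrow> (\<Sum>i\<in>A. f i) \<in> lincomb R x M"
  by (induction A rule: infinite_finite_induct) (auto intro: lincomb_add lincomb_0)

end

section \<open>Axioms of the cubical complex and the Koszul complex\<close>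

type_synonym 'p cell = "'p set \<times> 'p set"

text \<open>The sign between opposite faces is part of \<open>y\<close>, so \<open>u_rel\<close> is
  the cancellation along an edge. \<open>x_colon\<close> and \<open>y_colon\<close> make each
  variable a nonzerodivisor modulo any set of the others. The last four axioms say which
  \<open>u E\<close> lie in an ideal of variables, and that the others are nonzerodivisors modulo
  it.\<close>

locale cube_complex = ring_subset R for R :: "'r::comm_ring_1 set" +
  fixes P :: "'p set" and sg :: "'p \<Rightarrow> 'p set \<Rightarrow> 'r"
    and x y :: "'p \<Rightarrow> 'r" and u :: "'p set \<Rightarrow> 'r"
  assumes finP [simp, intro]: "finite P"
    and sgR [simp, intro]: "sg t T \<in> R" and sg_sq: "sg t T * sg t T = 1"
    and sg_swap: "s \<noteq> t \<Longrightarrow> s \<notin> T \<Longrightarrow> t \<notin> T \<Longrightarrow>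
        sg t T * sg s (insert t T) = - (sg s T * sg t (insert s T))"
    and xR [simp, intro]: "t \<in> P \<Longrightarrow> x t \<in> R" and yR [simp, intro]: "t \<in> P \<Longrightarrow> y t \<in> R"
    and uR [simp, intro]: "E \<subseteq> P \<Longrightarrow> u E \<in> R"
    and u_rel: "E \<subseteq> P \<Longrightarrow> t \<in> P - E \<Longrightarrow> x t * u E + y t * u (insert t E) = 0"
    and x_colon: "M \<subseteq> P \<Longrightarrow> t \<in> P - M \<Longrightarrow> f \<in> R \<Longrightarrow> x t * f \<in> lincomb R x M \<Longrightarrow> f \<in> lincomb R x M"
    and y_colon: "M \<subseteq> P \<Longrightarrow> t \<in> P - M \<Longrightarrow> f \<in> R \<Longrightarrow> y t * f \<in> lincomb R y M \<Longrightarrow> f \<in> lincomb R y M"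
    and ux_colon: "M \<subseteq> P \<Longrightarrow> E \<subseteq> P \<Longrightarrow> M \<inter> E = {} \<Longrightarrow> f \<in> R \<Longrightarrow>
        f * u E \<in> lincomb R x M \<Longrightarrow> f \<in> lincomb R x M"
    and uy_colon: "M \<subseteq> P \<Longrightarrow> E \<subseteq> P \<Longrightarrow> M \<subseteq> E \<Longrightarrow> f \<in> R \<Longrightarrow>
        f * u E \<in> lincomb R y M \<Longrightarrow> f \<in> lincomb R y M"
    and ux_mem: "M \<subseteq> P \<Longrightarrow> E \<subseteq> P \<Longrightarrow> M \<inter> E \<noteq> {} \<Longrightarrow> u E \<in> lincomb R x M"
    and uy_mem: "M \<subseteq> P \<Longrightarrow> E \<subseteq> P \<Longrightarrow> \<not> M \<subseteq> E \<Longrightarrow> u E \<in> lincomb R y M"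
begin

text \<open>Complementation exchanges the conditions \<open>M \<inter> E = {}\<close> and
  \<open>M \<subseteq> E\<close>, so the axioms for \<open>x\<close> and those for \<open>y\<close>
  change places. A result about bottoms of cells thus yields one about tops.\<close>

lemma dual: "cube_complex R P sg y x (\<lambda>E. u (P - E))"
proof unfold_locales
  show "y t * u (P - E) + x t * u (P - insert t E) = 0" if "E \<subseteq> P" "t \<in> P - E" for E t
  proof -
    have "insert t (P - insert t E) = P - E" using that by auto
    then show ?thesis using u_rel[of "P - insert t E" t] that by (auto simp: add.commute)
  qed
  show "f \<in> lincomb R y M" if "M \<subseteq> P" "E \<subseteq> P" "M \<inter> E = {}" "f \<in> R" "f * u (P - E) \<in> lincomb R y M" for M E f
    by (rule uy_colon[OF _ _ _ _ that(5)]) (use that in auto)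
  show "f \<in> lincomb R x M" if "M \<subseteq> P" "E \<subseteq> P" "M \<subseteq> E" "f \<in> R" "f * u (P - E) \<in> lincomb R x M" for M E f
    by (rule ux_colon[OF _ _ _ _ that(5)]) (use that in auto)
  show "u (P - E) \<in> lincomb R y M" if "M \<subseteq> P" "E \<subseteq> P" "M \<inter> E \<noteq> {}" for M E
    by (rule uy_mem) (use that in auto)
  show "u (P - E) \<in> lincomb R x M" if "M \<subseteq> P" "E \<subseteq> P" "\<not> M \<subseteq> E" for M E
    by (rule ux_mem) (use that in auto)
qed (fact sg_sq sg_swap x_colon y_colon finP | (simp; fail) | (rule sg_swap x_colon y_colon; assumption))+

text \<open>The condition on \<open>f {}\<close> says that \<open>f\<close> is also a cycle for the augmentation to \<open>R / (x)\<close>.\<close>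
lemma koszul_exact:
  assumes "M \<subseteq> P" and "\<And>T. T \<subseteq> M \<Longrightarrow> f T \<in> R"
    and "\<And>T. T \<subseteq> M \<Longrightarrow> (\<Sum>t\<in>M - T. sg t T * x t * f (insert t T)) = 0"
    and "f {} \<in> lincomb R x M"
  shows "\<exists>g. (\<forall>T. g T \<in> R) \<and> (\<forall>T\<subseteq>M. f T = (\<Sum>t\<in>M - T. sg t T * x t * g (insert t T)))"
proof -
  have "finite M" using assms(1) finite_subset by blast
  then show ?thesis using assms
  proof (induction M arbitrary: f rule: finite_induct)
    case empty
    then have "f {} = 0" by (auto simp: lincomb_def)
    then show ?case by (intro exI[of _ "\<lambda>_. 0"]) auto
  next
    case (insert a M)
    note a = insert(2) and MP = insert(4) and fR = insert(5) and cyc = insert(6) and f0 = insert(7)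
    have aP: "a \<in> P" "M \<subseteq> P" using MP by auto
    have split: "(\<Sum>t\<in>insert a M - T. sg t T * x t * h (insert t T))
        = sg a T * x a * h (insert a T) + (\<Sum>t\<in>M - T. sg t T * x t * h (insert t T))"
      if "T \<subseteq> M" for T and h :: "'p set \<Rightarrow> 'r"
    proof -
      have "insert a M - T = insert a (M - T)" "a \<notin> M - T" using that a by auto
      then show ?thesis using insert(1) by simp
    qed
    \<comment> \<open>\<open>sg_swap\<close> moves \<open>a\<close> past \<open>t\<close>: at sets
      containing \<open>a\<close>, the boundary over \<open>insert a M\<close> is the boundary over
      \<open>M\<close> up to the unit \<open>- sg a T\<close>.\<close>
    have split': "(\<Sum>t\<in>insert a M - insert a T. sg t (insert a T) * x t * h (insert t (insert a T)))
        = - sg a T * (\<Sum>t\<in>M - T. sg t T * x t * (sg a (insert t T) * h (insert a (insert t T))))"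
      if "T \<subseteq> M" for T and h :: "'p set \<Rightarrow> 'r"
    proof -
      have eq: "insert a M - insert a T = M - T" using a by auto
      have "sg t (insert a T) = - sg a T * (sg t T * sg a (insert t T))" if "t \<in> M - T" for t
      proof -
        have "sg a T * sg t (insert a T) = - (sg t T * sg a (insert t T))"
          using sg_swap[of t a T] that a \<open>T \<subseteq> M\<close> by auto
        then have "sg a T * (sg a T * sg t (insert a T)) = - sg a T * (sg t T * sg a (insert t T))"
          by simp
        then show ?thesis by (simp add: sg_sq mult.assoc[symmetric])
      qed
      then show ?thesis unfolding eq sum_distrib_left
        by (intro sum.cong) (auto simp: insert_commute mult_ac)
    qed
    \<comment> \<open>The coefficients of \<open>f\<close> at sets containing \<open>a\<close>, with
      the sign that makes them a Koszul cycle over \<open>M\<close>.\<close>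
    define f1 where "f1 T = sg a T * f (insert a T)" for T
    have f1cyc: "(\<Sum>t\<in>M - T. sg t T * x t * f1 (insert t T)) = 0" if "T \<subseteq> M" for T
    proof -
      have "- sg a T * (\<Sum>t\<in>M - T. sg t T * x t * f1 (insert t T)) = 0"
        using cyc[of "insert a T"] that unfolding f1_def split'[OF that, symmetric] by auto
      then have "sg a T * (sg a T * (\<Sum>t\<in>M - T. sg t T * x t * f1 (insert t T))) = 0"
        by simp
      then show ?thesis by (simp add: sg_sq mult.assoc[symmetric])
    qed
    have f1R: "f1 T \<in> R" if "T \<subseteq> M" for T
      unfolding f1_def using fR[of "insert a T"] that by auto
    \<comment> \<open>The cycle equation at the empty set puts \<open>x a * f1 {}\<close> into the
      ideal of \<open>M\<close>; cancelling \<open>x a\<close> gives the end condition for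
      \<open>f1\<close>.\<close>
    have "x a * f1 {} = - (\<Sum>t\<in>M. (sg t {} * f {t}) * x t)"
      using cyc[of "{}"] split[of "{}" f] unfolding f1_def
      by (simp add: mult_ac eq_neg_iff_add_eq_0)
    moreover have "sg t {} * f {t} \<in> R" if "t \<in> M" for t
      using fR[of "{t}"] that by auto
    then have "(\<Sum>t\<in>M. (sg t {} * f {t}) * x t) \<in> lincomb R x M"
      by (rule lincombI)
    ultimately have "x a * f1 {} \<in> lincomb R x M" using lincomb_uminus by simp
    then have "f1 {} \<in> lincomb R x M"
      using x_colon[of M a "f1 {}"] aP a f1R by auto
    then obtain g1 where g1R: "\<And>T. g1 T \<in> R"
      and g1: "\<And>T. T \<subseteq> M \<Longrightarrow> f1 T = (\<Sum>t\<in>M - T. sg t T * x t * g1 (insert t T))"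
      using insert.IH[of f1, OF aP(2) f1R f1cyc] by blast
    obtain c where c: "f {} = (\<Sum>t\<in>insert a M. c t * x t)" "\<And>t. c t \<in> R"
      using f0 unfolding lincomb_def by blast
    \<comment> \<open>The boundary never reads the value at the empty set, so it is free. It is
      chosen to cancel the \<open>x a\<close> term of \<open>f {}\<close>, which puts
      \<open>f2 {}\<close> into the ideal of \<open>M\<close>.\<close>
    define g2 where "g2 = g1({} := - c a)"
    have g2R: "g2 T \<in> R" for T unfolding g2_def using g1R c by auto
    have g2: "f1 T = (\<Sum>t\<in>M - T. sg t T * x t * g2 (insert t T))" if "T \<subseteq> M" for T
      using g1[OF that] unfolding g2_def by auto
    define f2 where "f2 T = f T + x a * g2 T" for T
    have "f2 {} = (\<Sum>t\<in>M. c t * x t)"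
      unfolding f2_def g2_def using c insert(1) a by simp
    then have f20: "f2 {} \<in> lincomb R x M" using lincombI[of M c x] c(2) by simp
    have f2R: "f2 T \<in> R" if "T \<subseteq> M" for T
      unfolding f2_def using fR[of T] that g2R aP by auto
    have "(\<Sum>t\<in>M - T. sg t T * x t * f2 (insert t T)) = 0" if "T \<subseteq> M" for T
    proof -
      have "(\<Sum>t\<in>M - T. sg t T * x t * f2 (insert t T)) =
         (\<Sum>t\<in>M - T. sg t T * x t * f (insert t T)) + x a * f1 T"
        unfolding f2_def g2[OF that] by (simp add: algebra_simps sum.distrib sum_distrib_left)
      also have "\<dots> = 0" using cyc[of T] split[OF that, of f] that
        unfolding f1_def by (simp add: subset_insertI2 algebra_simps)
      finally show ?thesis .
    qed
    then obtain g0 where g0R: "\<And>T. g0 T \<in> R"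
      and g0: "\<And>T. T \<subseteq> M \<Longrightarrow> f2 T = (\<Sum>t\<in>M - T. sg t T * x t * g0 (insert t T))"
      using insert.IH[of f2, OF aP(2) f2R _ f20] by blast
    \<comment> \<open>The first branch contributes \<open>- x a * g2 T\<close> to the boundary at a
      set \<open>T\<close> without \<open>a\<close>, and \<open>g0\<close> contributes
      \<open>f2 T\<close>; together they give \<open>f T\<close>.\<close>
    define g where "g T = (if a \<in> T then - (sg a (T - {a}) * g2 (T - {a})) else g0 T)" for T
    have gR: "g T \<in> R" for T unfolding g_def using g0R g2R by auto
    have ga: "g (insert a T) = - (sg a T * g2 T)" if "a \<notin> T" for T
      unfolding g_def using that by auto
    have "f T = (\<Sum>t\<in>insert a M - T. sg t T * x t * g (insert t T))" if T: "T \<subseteq> insert a M" for T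
    proof (cases "a \<in> T")
      case False
      then have TM: "T \<subseteq> M" using T by auto
      have "(\<Sum>t\<in>M - T. sg t T * x t * g (insert t T)) = f2 T"
        unfolding g0[OF TM] using False a by (intro sum.cong) (auto simp: g_def)
      moreover have "sg a T * x a * g (insert a T) = - ((sg a T * sg a T) * (x a * g2 T))"
        unfolding ga[OF False] by (simp add: mult_ac)
      ultimately show ?thesis unfolding split[OF TM] f2_def sg_sq by simp
    next
      case True
      define T' where "T' = T - {a}"
      have T': "T' \<subseteq> M" "T = insert a T'" "a \<notin> T'" using T True T'_def by auto
      have "(\<Sum>t\<in>M - T'. sg t T' * x t * (sg a (insert t T') * g (insert a (insert t T'))))
          = - f1 T'" unfolding g2[OF T'(1)] sum_negf[symmetric]
      proof (intro sum.cong refl)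
        fix t assume t: "t \<in> M - T'"
        then have "a \<notin> insert t T'" using a T' by auto
        then have "sg a (insert t T') * g (insert a (insert t T')) = - g2 (insert t T')"
          using sg_sq[of a "insert t T'"] by (simp add: ga mult.assoc[symmetric])
        then show "sg t T' * x t * (sg a (insert t T') * g (insert a (insert t T'))) = - (sg t T' * x t * g2 (insert t T'))"
          by simp
      qed
      then show ?thesis unfolding T'(2) split'[OF T'(1)] f1_def
        using sg_sq[of a T'] by (simp add: mult.assoc[symmetric])
    qed
    then show ?case using gR by blast
  qed
qed

end

section \<open>The cubical complex\<close>

context cube_complex begin

text \<open>A chain is given by its coefficients, so the value of \<open>delta z\<close> at a cell collects \<open>z\<close> over its
  cofaces: \<open>(E, T)\<close> is the lower face of \<open>(E, insert t T)\<close> if \<open>t \<notin> E\<close>, and the upper face of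
  \<open>(E - {t}, insert t T)\<close> if \<open>t \<in> E\<close>. No face condition on cells is needed, since chains vanish off
  the cell set.\<close>
definition delta :: "('p cell \<Rightarrow> 'r) \<Rightarrow> 'p cell \<Rightarrow> 'r" where
  "delta z = (\<lambda>(E, T). \<Sum>t\<in>P - T. sg t T * (if t \<in> E then y t else x t) * z (E - {t}, insert t T))"

definition aug :: "('p cell \<Rightarrow> 'r) \<Rightarrow> 'r" where
  "aug z = (\<Sum>E\<in>Pow P. z (E, {}) * u E)"

definition chains :: "'p cell set \<Rightarrow> ('p cell \<Rightarrow> 'r) set" where
  "chains X = {z. \<forall>c. z c \<in> R \<and> (c \<notin> X \<longrightarrow> z c = 0)}"

definition face_closed :: "'p cell set \<Rightarrow> bool" where
  "face_closed X \<longleftrightarrow> (\<forall>E T t. t \<in> P - T \<longrightarrow> (E - {t}, insert t T) \<in> X \<longrightarrow> (E, T) \<in> X)"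

lemma delta_add: "delta (\<lambda>c. z c + w c) c = delta z c + delta w c"
  by (cases c) (simp add: delta_def algebra_simps sum.distrib)

lemma delta_diff: "delta (\<lambda>c. z c - w c) c = delta z c - delta w c"
  by (cases c) (simp add: delta_def algebra_simps sum_subtractf)

lemma delta_zero: "delta (\<lambda>c. 0) c = 0"
  by (cases c) (simp add: delta_def)

lemma delta_scale: "delta (\<lambda>c. r * z c) c = r * delta z c"
  by (cases c) (simp add: delta_def algebra_simps sum_distrib_left)

lemma aug_add: "aug (\<lambda>c. z c + w c) = aug z + aug w"
  by (simp add: aug_def algebra_simps sum.distrib)

lemma aug_diff: "aug (\<lambda>c. z c - w c) = aug z - aug w"
  by (simp add: aug_def algebra_simps sum_subtractf)

lemma aug_scale: "aug (\<lambda>c. r * z c) = r * aug z"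
  by (simp add: aug_def algebra_simps sum_distrib_left)

lemma chainsD: "z \<in> chains X \<Longrightarrow> z c \<in> R" "z \<in> chains X \<Longrightarrow> c \<notin> X \<Longrightarrow> z c = 0"
  unfolding chains_def by blast+

lemma chainsI: "(\<And>c. z c \<in> R) \<Longrightarrow> (\<And>c. c \<notin> X \<Longrightarrow> z c = 0) \<Longrightarrow> z \<in> chains X"
  by (auto simp: chains_def)

lemma chains_mono: "z \<in> chains X \<Longrightarrow> X \<subseteq> Y \<Longrightarrow> z \<in> chains Y"
  by (auto simp: chains_def)

lemma chains_add: "z \<in> chains X \<Longrightarrow> w \<in> chains X \<Longrightarrow> (\<lambda>c. z c + w c) \<in> chains X"
  by (rule chainsI) (simp_all add: chainsD Radd)

lemma chains_diff: "z \<in> chains X \<Longrightarrow> w \<in> chains X \<Longrightarrow> (\<lambda>c. z c - w c) \<in> chains X"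
  by (rule chainsI) (simp_all add: chainsD Rdiff)

lemma delta_in_R:
  assumes "\<And>c. z c \<in> R"
  shows "delta z c \<in> R"
  using assms by (cases c) (auto simp: delta_def intro!: Rsum Rmult)

lemma delta_chains:
  assumes "face_closed X" "z \<in> chains X"
  shows "delta z \<in> chains X"
proof (rule chainsI)
  show "delta z c \<in> R" for c using delta_in_R chainsD(1)[OF assms(2)] by blast
  show "delta z c = 0" if "c \<notin> X" for c
  proof (cases c)
    case (Pair E T)
    have "z (E - {t}, insert t T) = 0" if "t \<in> P - T" for t
      using that assms(1) \<open>c \<notin> X\<close> Pair chainsD(2)[OF assms(2)] unfolding face_closed_def by blast
    then show ?thesis unfolding Pair delta_def by simp
  qed
qed

lemma delta_delta: "delta (delta z) c = 0"
proof (cases c)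
  case (Pair E T)
  define k where "k t = (if t \<in> E then y t else x t)" for t
  define f where "f t s = sg t T * k t * (sg s (insert t T) * k s * z (E - {t} - {s}, insert s (insert t T)))" for t s
  have "delta (delta z) c = (\<Sum>t\<in>P - T. \<Sum>s\<in>P - T - {t}. f t s)"
    unfolding Pair delta_def prod.case f_def k_def sum_distrib_left
    by (intro sum.cong) auto
  also have "\<dots> = 0"
  proof (rule sum_antisymmetric)
    show "f s t + f t s = 0" if "s \<in> P - T" "t \<in> P - T" "s \<noteq> t" for s t
    proof -
      have "E - {t} - {s} = E - {s} - {t}" by auto
      then have "f t s + f s t = (sg t T * sg s (insert t T) + sg s T * sg t (insert s T))
          * (k t * k s * z (E - {s} - {t}, insert s (insert t T)))"
        unfolding f_def by (simp add: insert_commute algebra_simps)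
      also have "\<dots> = 0" using sg_swap[of s t T] that by simp
      finally show ?thesis by (simp add: add.commute)
    qed
  qed simp
  finally show ?thesis .
qed

text \<open>The ends \<open>E\<close> and \<open>insert t E\<close> of each edge in direction
  \<open>t\<close> cancel by \<open>u_rel\<close>; hence the subsets of \<open>P\<close> are grouped
  by whether they contain \<open>t\<close>.\<close>

lemma aug_delta: "aug (delta z) = 0"
proof -
  have "aug (delta z) = (\<Sum>t\<in>P. \<Sum>E\<in>Pow P.
      sg t {} * (if t \<in> E then y t else x t) * z (E - {t}, {t}) * u E)"
    unfolding aug_def delta_def by (simp add: sum_distrib_right) (rule sum.swap)
  also have "\<dots> = 0"
  proof (rule sum.neutral, rule ballI)
    fix t assume t: "t \<in> P"
    define h where "h E = sg t {} * (if t \<in> E then y t else x t) * z (E - {t}, {t}) * u E" for E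
    have Pow: "Pow P = Pow (P - {t}) \<union> insert t ` Pow (P - {t})"
      using t Pow_insert[of t "P - {t}"] by (simp add: insert_absorb)
    have inj: "inj_on (insert t) (Pow (P - {t}))"
      by (rule inj_onI) (metis Diff_insert_absorb Diff_iff PowD insertI1 subsetD)
    have "sum h (Pow P) = sum h (Pow (P - {t})) + sum h (insert t ` Pow (P - {t}))"
      unfolding Pow by (rule sum.union_disjoint) auto
    also have "\<dots> = (\<Sum>E\<in>Pow (P - {t}). h E + h (insert t E))"
      by (simp add: sum.reindex[OF inj] sum.distrib)
    also have "\<dots> = 0"
    proof (rule sum.neutral, rule ballI)
      fix E assume E: "E \<in> Pow (P - {t})"
      then have "t \<notin> E" "insert t E - {t} = E" "E - {t} = E" by auto
      then have "h E + h (insert t E) = sg t {} * z (E, {t}) * (x t * u E + y t * u (insert t E))"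
        unfolding h_def by (simp add: algebra_simps)
      also have "\<dots> = 0" using u_rel[of E t] E t \<open>t \<notin> E\<close> by (auto simp: subset_Diff_insert)
      finally show "h E + h (insert t E) = 0" .
    qed
    finally show "(\<Sum>E\<in>Pow P. sg t {} * (if t \<in> E then y t else x t) * z (E - {t}, {t}) * u E) = 0"
      unfolding h_def .
  qed
  finally show ?thesis .
qed

section \<open>Exactness of complexes of cells\<close>

text \<open>Chains mix dimensions, so one condition covers every place of the augmented complex:
  \<open>aug\<close> sees only vertices, and \<open>delta\<close> kills them.\<close>

definition exact :: "'p cell set \<Rightarrow> bool" where
  "exact X \<longleftrightarrow> (\<forall>z\<in>chains X. delta z = (\<lambda>_. 0) \<longrightarrow> aug z = 0 \<longrightarrow> (\<exists>w\<in>chains X. delta w = z))"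

definition cubes :: "'p set set \<Rightarrow> 'p cell set" where
  "cubes L = {(E, T). E \<subseteq> P \<and> T \<subseteq> P \<and> E \<inter> T = {} \<and> (\<forall>T'\<subseteq>T. E \<union> T' \<in> L)}"

lemma cubes_face:
  assumes "(E - {t}, insert t T) \<in> cubes L" "t \<in> P - T"
  shows "(E, T) \<in> cubes L"
proof -
  have L: "E - {t} \<union> T' \<in> L" if "T' \<subseteq> insert t T" for T'
    using assms that by (auto simp: cubes_def)
  have "E \<union> T' \<in> L" if "T' \<subseteq> T" for T'
  proof (cases "t \<in> E")
    case True
    then have "E \<union> T' = E - {t} \<union> insert t T'" by auto
    then show ?thesis using L[of "insert t T'"] that by auto
  next
    case False
    then show ?thesis using L[of T'] that by auto
  qed
  then show ?thesis using assms unfolding cubes_def by auto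
qed

lemma face_closed_cubes: "face_closed (cubes L)"
  unfolding face_closed_def using cubes_face by blast

lemma cubes_in: "(E, T) \<in> cubes L \<Longrightarrow> E \<in> L" "(E, T) \<in> cubes L \<Longrightarrow> E \<union> T \<in> L"
proof -
  assume "(E, T) \<in> cubes L"
  then have "\<forall>T'\<subseteq>T. E \<union> T' \<in> L" unfolding cubes_def by auto
  then show "E \<in> L" "E \<union> T \<in> L" by (metis empty_subsetI sup_bot.right_neutral, blast)
qed

text \<open>For \<open>F\<close> upward closed in \<open>L\<close> these are the cells with all
  vertices in \<open>F\<close>; dually for \<open>down_cubes\<close>.\<close>

definition up_cubes :: "'p set set \<Rightarrow> 'p set set \<Rightarrow> 'p cell set" where
  "up_cubes L F = {c \<in> cubes L. fst c \<in> F}"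

definition down_cubes :: "'p set set \<Rightarrow> 'p set set \<Rightarrow> 'p cell set" where
  "down_cubes L F = {c \<in> cubes L. fst c \<union> snd c \<in> F}"

lemma face_closed_up:
  assumes "\<And>E D. E \<in> F \<Longrightarrow> D \<in> L \<Longrightarrow> E \<subseteq> D \<Longrightarrow> D \<in> F"
  shows "face_closed (up_cubes L F)"
  unfolding face_closed_def
proof (intro allI impI)
  fix E T t assume t: "t \<in> P - T" and "(E - {t}, insert t T) \<in> up_cubes L F"
  then have c: "(E - {t}, insert t T) \<in> cubes L" and F: "E - {t} \<in> F"
    by (auto simp: up_cubes_def)
  have "(E, T) \<in> cubes L" using cubes_face[OF c t] .
  then show "(E, T) \<in> up_cubes L F"
    using assms[OF F, of E] cubes_in(1)[of E T] by (auto simp: up_cubes_def)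
qed

lemma face_closed_down:
  assumes "\<And>E D. D \<in> F \<Longrightarrow> E \<in> L \<Longrightarrow> E \<subseteq> D \<Longrightarrow> E \<in> F"
  shows "face_closed (down_cubes L F)"
  unfolding face_closed_def
proof (intro allI impI)
  fix E T t assume t: "t \<in> P - T" and "(E - {t}, insert t T) \<in> down_cubes L F"
  then have c: "(E - {t}, insert t T) \<in> cubes L" and F: "E - {t} \<union> insert t T \<in> F"
    by (auto simp: down_cubes_def)
  have "(E, T) \<in> cubes L" using cubes_face[OF c t] .
  then show "(E, T) \<in> down_cubes L F"
    using assms[OF F, of "E \<union> T"] cubes_in(2)[of E T] by (auto simp: down_cubes_def)
qed

text \<open>A cycle is cleared bottom by bottom, smallest bottoms first. A coface of a cell has the
  same bottom or a smaller one, so at the least size in the support the cycle equation is a Koszul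
  equation.\<close>

lemma exact_up:
  assumes LP: "L \<subseteq> Pow P" and Lun: "\<And>D E. D \<in> L \<Longrightarrow> E \<in> L \<Longrightarrow> D \<union> E \<in> L"
    and sep: "\<And>D E. D \<in> L \<Longrightarrow> E \<in> L \<Longrightarrow> \<not> D \<subseteq> E \<Longrightarrow> \<exists>t\<in>D - E. insert t E \<in> L"
    and FL: "F \<subseteq> L" and Fup: "\<And>E D. E \<in> F \<Longrightarrow> D \<in> L \<Longrightarrow> E \<subseteq> D \<Longrightarrow> D \<in> F"
  shows "exact (up_cubes L F)"
proof -
  let ?X = "up_cubes L F"
  define M where "M E = {t \<in> P - E. insert t E \<in> L}" for E
  have ME: "M E \<subseteq> P" "M E \<inter> E = {}" "finite (M E)" for E
    by (auto simp: M_def intro: finite_subset[OF _ finP])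
  \<comment> \<open>Since \<open>L\<close> is closed under unions, elements that can be added to
    \<open>E\<close> singly can be added together: the cells with bottom \<open>E\<close> form a
    full simplex on \<open>M E\<close>.\<close>
  have fib: "(E, T) \<in> ?X \<longleftrightarrow> T \<subseteq> M E" if E: "E \<in> F" for E T
  proof
    assume "(E, T) \<in> ?X"
    then have *: "T \<subseteq> P" "E \<inter> T = {}" "\<forall>T'\<subseteq>T. E \<union> T' \<in> L"
      by (auto simp: up_cubes_def cubes_def)
    have "E \<union> {t} \<in> L" if "t \<in> T" for t
      using *(3) that by blast
    then show "T \<subseteq> M E" using * by (auto simp: M_def)
  next
    assume T: "T \<subseteq> M E"
    have "E \<union> T' \<in> L" if "T' \<subseteq> M E" for T'
    proof -
      have "finite T'" using that ME(3) finite_subset by blast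
      then show ?thesis using that
      proof (induction T' rule: finite_induct)
        case empty
        then show ?case using E FL by auto
      next
        case (insert t T')
        then have "E \<union> T' \<in> L" "insert t E \<in> L" by (auto simp: M_def)
          then have "(E \<union> T') \<union> (insert t E) \<in> L" by (rule Lun)
        moreover have "(E \<union> T') \<union> (insert t E) = E \<union> insert t T'" by auto
        ultimately show ?case by simp
      qed
    qed
    then show "(E, T) \<in> ?X" using T E FL LP by (auto simp: up_cubes_def cubes_def M_def)
  qed
  \<comment> \<open>\<open>k\<close> bounds how far the bottoms in the support may fall below
    \<open>card P\<close> in size. For \<open>k = 0\<close> no cell remains, and
    \<open>Suc (card P)\<close> admits every cell.\<close>
  have "\<exists>w\<in>chains ?X. delta w = z"
    if "z \<in> chains ?X" "delta z = (\<lambda>_. 0)" "aug z = 0" "\<And>E T. z (E, T) \<noteq> 0 \<Longrightarrow> card P < card E + k" for z k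
    using that
  proof (induction k arbitrary: z)
    case 0
    have "z c = 0" for c
    proof (cases c)
      case (Pair E T)
      show ?thesis
      proof (rule ccontr)
        assume "z c \<noteq> 0"
        then have "c \<in> ?X" "card P < card E" using Pair 0 chainsD(2)[OF 0(1)] by auto
        then show False using Pair card_mono[OF finP, of E] by (auto simp: up_cubes_def cubes_def)
      qed
    qed
    then show ?case by (intro bexI[of _ "\<lambda>_. 0"]) (auto simp: chains_def delta_zero)
  next
    case (Suc k)
    have low: "z (E, T) = 0" if "card E + k < card P" for E T
      using Suc(5)[of E T] that by force
    have "\<exists>g. (\<forall>T. g T \<in> R) \<and> (\<forall>T\<subseteq>M E. z (E, T) = (\<Sum>t\<in>M E - T. sg t T * x t * g (insert t T)))"
      if E: "E \<in> F" "card E + k = card P" for E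
    proof (rule koszul_exact)
      have EP: "E \<subseteq> P" using E FL LP by auto
      then have fE: "finite E" using finP finite_subset by blast
      show "M E \<subseteq> P" "z (E, T) \<in> R" for T using ME chainsD(1)[OF Suc(2)] by auto
      show "(\<Sum>t\<in>M E - T. sg t T * x t * z (E, insert t T)) = 0" if T: "T \<subseteq> M E" for T
      proof -
        have "0 = delta z (E, T)" using Suc by simp
        also have "\<dots> = (\<Sum>t\<in>M E - T. sg t T * (if t \<in> E then y t else x t) * z (E - {t}, insert t T))"
          unfolding delta_def prod.case
        proof (rule sum.mono_neutral_right)
          show "\<forall>t\<in>P - T - (M E - T). sg t T * (if t \<in> E then y t else x t) * z (E - {t}, insert t T) = 0"
          proof
            fix t assume t: "t \<in> P - T - (M E - T)"
            have "z (E - {t}, insert t T) = 0"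
            proof (cases "t \<in> E")
              case True
              then have "card (E - {t}) < card E" using fE by (intro card_Diff1_less)
              then show ?thesis using low E by simp
            next
              case False
              then have "(E, insert t T) \<notin> ?X" using t fib[OF E(1)] by auto
              then show ?thesis using False chainsD(2)[OF Suc(2)] by simp
            qed
            then show "sg t T * (if t \<in> E then y t else x t) * z (E - {t}, insert t T) = 0" by simp
          qed
        qed (use ME in auto)
        also have "\<dots> = (\<Sum>t\<in>M E - T. sg t T * x t * z (E, insert t T))"
        proof (rule sum.cong[OF refl])
          fix t assume "t \<in> M E - T"
          then have "t \<notin> E" using ME by auto
          then show "sg t T * (if t \<in> E then y t else x t) * z (E - {t}, insert t T) = sg t T * x t * z (E, insert t T)"
            by simp
        qed
        finally show ?thesis by simp
      qed
      \<comment> \<open>The augmentation supplies the end condition of \<open>koszul_exact\<close>: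
        every other vertex \<open>D\<close> in the support is at least as large as \<open>E\<close>,
        so it is not inside \<open>E\<close> and by \<open>sep\<close> meets
        \<open>M E\<close>.\<close>
      have "z (E, {}) * u E + (\<Sum>D\<in>Pow P - {E}. z (D, {}) * u D) = 0"
        using Suc(4) EP unfolding aug_def by (subst (asm) sum.remove[of _ E]) auto
      then have "z (E, {}) * u E = - (\<Sum>D\<in>Pow P - {E}. z (D, {}) * u D)"
        by (simp add: eq_neg_iff_add_eq_0)
      also have "\<dots> \<in> lincomb R x (M E)"
      proof (intro lincomb_uminus lincomb_sum)
        fix D assume D: "D \<in> Pow P - {E}"
        show "z (D, {}) * u D \<in> lincomb R x (M E)"
        proof (cases "z (D, {}) = 0")
          case False
          then have "(D, {}) \<in> ?X" using chainsD(2)[OF Suc(2)] by blast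
          then have DL: "D \<in> L" using FL by (auto simp: up_cubes_def)
          have "card E \<le> card D" using low[of D "{}"] False E by linarith
          then have "\<not> D \<subseteq> E" using card_seteq[OF fE, of D] D by auto
          then obtain t where "t \<in> D - E" "insert t E \<in> L" using sep[OF DL, of E] E FL by auto
          then have "M E \<inter> D \<noteq> {}" using D by (auto simp: M_def)
          then show ?thesis using D ME chainsD(1)[OF Suc(2)] by (intro lincomb_mult ux_mem) auto
        qed (simp add: lincomb_0)
      qed
      finally show "z (E, {}) \<in> lincomb R x (M E)"
        using ux_colon[of "M E" E] ME EP chainsD(1)[OF Suc(2)] by auto
    qed
    then have "\<forall>E. \<exists>g. E \<in> F \<and> card E + k = card P \<longrightarrow>
        (\<forall>T. g T \<in> R) \<and> (\<forall>T\<subseteq>M E. z (E, T) = (\<Sum>t\<in>M E - T. sg t T * x t * g (insert t T)))"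
      by blast
    from choice[OF this] obtain g where g': "\<forall>E. E \<in> F \<and> card E + k = card P \<longrightarrow>
        (\<forall>T. g E T \<in> R) \<and> (\<forall>T\<subseteq>M E. z (E, T) = (\<Sum>t\<in>M E - T. sg t T * x t * g E (insert t T)))" ..
    then have gR: "g E T \<in> R" if "E \<in> F" "card E + k = card P" for E T
      using that by blast
    have g: "z (E, T) = (\<Sum>t\<in>M E - T. sg t T * x t * g E (insert t T))"
      if "E \<in> F" "card E + k = card P" "T \<subseteq> M E" for E T
      using g' that by blast
    \<comment> \<open>The Koszul preimages at all bottoms of the least size. Subtracting
      \<open>delta w\<close> clears these bottoms and disturbs only larger ones.\<close>
    define w where "w = (\<lambda>(E, T). if E \<in> F \<and> card E + k = card P \<and> T \<subseteq> M E then g E T else 0)"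
    have w: "w \<in> chains ?X"
      by (rule chainsI) (auto simp: w_def gR fib split: prod.splits)
    have fc: "face_closed ?X" using face_closed_up Fup by blast
    have zw: "(\<lambda>c. z c - delta w c) \<in> chains ?X"
      using chains_diff delta_chains Suc w fc by blast
    have "\<exists>w'\<in>chains ?X. delta w' = (\<lambda>c. z c - delta w c)"
    proof (rule Suc.IH[OF zw])
      show "delta (\<lambda>c. z c - delta w c) = (\<lambda>_. 0)"
        using Suc(3) by (intro ext) (simp add: delta_diff delta_delta)
      show "aug (\<lambda>c. z c - delta w c) = 0"
        using Suc(4) aug_delta[of w] by (simp add: aug_diff)
      show "card P < card E + k" if nz: "z (E, T) - delta w (E, T) \<noteq> 0" for E T
      proof (rule ccontr)
        assume "\<not> card P < card E + k"
        then have cE: "card E + k \<le> card P" by simp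
        have "(E, T) \<in> ?X" using nz chainsD(2)[OF zw, of "(E, T)"] by auto
        then have E: "E \<in> F" and T: "T \<subseteq> M E" using fib[of E T] by (auto simp: up_cubes_def)
        have "E \<subseteq> P" using E FL LP by auto
        then have fE: "finite E" using finP finite_subset by blast
        have "delta w (E, T) = (\<Sum>t\<in>M E - T. sg t T * (if t \<in> E then y t else x t) * w (E - {t}, insert t T))"
          unfolding delta_def prod.case
        proof (rule sum.mono_neutral_right)
          show "\<forall>t\<in>P - T - (M E - T). sg t T * (if t \<in> E then y t else x t) * w (E - {t}, insert t T) = 0"
          proof
            fix t assume t: "t \<in> P - T - (M E - T)"
            have "w (E - {t}, insert t T) = 0"
            proof (cases "t \<in> E")
              case True
              then have "card (E - {t}) < card E" using fE by (intro card_Diff1_less)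
              then show ?thesis using cE by (simp add: w_def)
            next
              case False
              then show ?thesis using t by (auto simp: w_def)
            qed
            then show "sg t T * (if t \<in> E then y t else x t) * w (E - {t}, insert t T) = 0" by simp
          qed
        qed (use ME in auto)
        also have "\<dots> = (\<Sum>t\<in>M E - T. sg t T * x t * w (E, insert t T))"
        proof (rule sum.cong[OF refl])
          fix t assume "t \<in> M E - T"
          then have "t \<notin> E" using ME by auto
          then show "sg t T * (if t \<in> E then y t else x t) * w (E - {t}, insert t T) = sg t T * x t * w (E, insert t T)"
            by simp
        qed
        also have "\<dots> = z (E, T)"
        proof (cases "card E + k = card P")
          case True
          show ?thesis unfolding g[OF E True T] using E True T
            by (intro sum.cong) (auto simp: w_def)
        next
          case False
          then show ?thesis using low[of E T] cE by (simp add: w_def)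
        qed
        finally show False using nz by simp
      qed
    qed
    then obtain w' where w': "w' \<in> chains ?X" "delta w' = (\<lambda>c. z c - delta w c)" by blast
    have "delta (\<lambda>c. w' c + w c) = z"
      by (rule ext) (simp add: delta_add w')
    then show ?case using chains_add[OF w'(1) w] by (rule bexI)
  qed
  moreover have "card P < card E + Suc (card P)" for E :: "'p set" by simp
  ultimately show ?thesis unfolding exact_def by blast
qed

text \<open>Passing to complements in \<open>P\<close> exchanges \<open>x\<close> with \<open>y\<close> and up-sets with down-sets of cells.\<close>
definition flip :: "('p cell \<Rightarrow> 'r) \<Rightarrow> 'p cell \<Rightarrow> 'r" where
  "flip z = (\<lambda>(E, T). if E \<subseteq> P \<and> T \<subseteq> P \<and> E \<inter> T = {} then z (P - E - T, T) else 0)"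

text \<open>The direction set \<open>T\<close>, and with it every sign, is unchanged, while lower
  and upper faces in each direction are exchanged.\<close>

lemma flip_delta:
  assumes "z \<in> chains (cubes (Pow P))"
  shows "cube_complex.delta P sg y x (flip z) = flip (delta z)"
proof
  interpret D: cube_complex R P sg y x "\<lambda>E. u (P - E)" by (rule dual)
  fix c :: "'p cell"
  obtain E T where c: "c = (E, T)" by (cases c)
  show "D.delta (flip z) c = flip (delta z) c"
  proof (cases "E \<subseteq> P \<and> T \<subseteq> P \<and> E \<inter> T = {}")
    case True
    have "sg t T * (if t \<in> E then x t else y t) * flip z (E - {t}, insert t T)
        = sg t T * (if t \<in> P - E - T then y t else x t) * z (P - E - T - {t}, insert t T)"
      if t: "t \<in> P - T" for t
    proof -
      have "P - (E - {t}) - insert t T = P - E - T - {t}" using t by auto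
      then have "flip z (E - {t}, insert t T) = z (P - E - T - {t}, insert t T)"
        using True t unfolding flip_def by auto
      then show ?thesis using t by auto
    qed
    then have "D.delta (flip z) c = delta z (P - E - T, T)"
      unfolding c D.delta_def delta_def by simp
    then show ?thesis using True unfolding c flip_def by simp
  next
    case False
    have "flip z (E - {t}, insert t T) = 0" if "t \<in> P - T" for t
      using False that unfolding flip_def by auto
    then have "D.delta (flip z) c = 0" unfolding c D.delta_def by simp
    then show ?thesis using False unfolding c flip_def by auto
  qed
qed

lemma flip_flip:
  assumes "z \<in> chains (cubes L)"
  shows "flip (flip z) = z"
proof
  fix c :: "'p cell"
  obtain E T where c: "c = (E, T)" by (cases c)
  show "flip (flip z) c = z c"
  proof (cases "E \<subseteq> P \<and> T \<subseteq> P \<and> E \<inter> T = {}")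
    case True
    then have "P - (P - E - T) - T = E" by auto
    then show ?thesis using True unfolding c flip_def by auto
  next
    case False
    then have "c \<notin> cubes L" unfolding c cubes_def by auto
    then show ?thesis using False chainsD(2)[OF assms] unfolding c flip_def by auto
  qed
qed

lemma flip_aug: "(\<Sum>E\<in>Pow P. flip z (E, {}) * u (P - E)) = aug z"
  unfolding aug_def
  by (rule sum.reindex_bij_witness[of _ "\<lambda>E. P - E" "\<lambda>E. P - E"]) (auto simp: flip_def double_diff)

lemma flip_chains:
  assumes "z \<in> chains (down_cubes L F)"
  shows "flip z \<in> chains (up_cubes ((-) P ` L) ((-) P ` F))"
proof (rule chainsI)
  show "flip z c \<in> R" for c using chainsD(1)[OF assms] by (auto simp: flip_def split: prod.splits)
  fix c assume c: "c \<notin> up_cubes ((-) P ` L) ((-) P ` F)"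
  obtain E T where ET: "c = (E, T)" by (cases c)
  show "flip z c = 0"
  proof (rule ccontr)
    assume nz: "flip z c \<noteq> 0"
    then have *: "E \<subseteq> P" "T \<subseteq> P" "E \<inter> T = {}" and "z (P - E - T, T) \<noteq> 0"
      unfolding ET flip_def by (auto split: if_splits)
    then have "(P - E - T, T) \<in> down_cubes L F" using chainsD(2)[OF assms] by blast
    then have L: "\<forall>T'\<subseteq>T. P - E - T \<union> T' \<in> L" and F: "P - E - T \<union> T \<in> F"
      by (auto simp: down_cubes_def cubes_def)
    \<comment> \<open>Complementation reverses the interval: the vertex given by \<open>T'\<close>
      comes from the one given by \<open>T - T'\<close>.\<close>
    have "E \<union> T' \<in> (-) P ` L" if "T' \<subseteq> T" for T'
    proof -
      have "E \<union> T' = P - (P - E - T \<union> (T - T'))" using * that by auto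
      moreover have "P - E - T \<union> (T - T') \<in> L" using L by auto
      ultimately show ?thesis by blast
    qed
    moreover have "E = P - (P - E - T \<union> T)" using * by auto
    then have "E \<in> (-) P ` F" using F by blast
    ultimately show False using c * unfolding ET by (auto simp: up_cubes_def cubes_def)
  qed
qed

lemma flip_chains':
  assumes "z \<in> chains (up_cubes ((-) P ` L) ((-) P ` F))" "L \<subseteq> Pow P" "F \<subseteq> L"
  shows "flip z \<in> chains (down_cubes L F)"
proof (rule chainsI)
  show "flip z c \<in> R" for c using chainsD(1)[OF assms(1)] by (auto simp: flip_def split: prod.splits)
  fix c assume c: "c \<notin> down_cubes L F"
  obtain E T where ET: "c = (E, T)" by (cases c)
  show "flip z c = 0"
  proof (rule ccontr)
    assume nz: "flip z c \<noteq> 0"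
    then have *: "E \<subseteq> P" "T \<subseteq> P" "E \<inter> T = {}" and "z (P - E - T, T) \<noteq> 0"
      unfolding ET flip_def by (auto split: if_splits)
    then have "(P - E - T, T) \<in> up_cubes ((-) P ` L) ((-) P ` F)" using chainsD(2)[OF assms(1)] by blast
    then have L: "\<forall>T'\<subseteq>T. P - E - T \<union> T' \<in> (-) P ` L" and F: "P - E - T \<in> (-) P ` F"
      by (auto simp: up_cubes_def cubes_def)
    have "E \<union> T' \<in> L" if "T' \<subseteq> T" for T'
    proof -
      obtain D where D: "D \<in> L" "P - E - T \<union> (T - T') = P - D" using L by blast
      then have "D = P - (P - E - T \<union> (T - T'))" using assms(2) by (auto simp: double_diff)
      also have "\<dots> = E \<union> T'" using * that by auto
      finally show ?thesis using D by simp
    qed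
    moreover obtain D where D: "D \<in> F" "P - E - T = P - D" using F by blast
    then have "D = P - (P - E - T)" using assms(2,3) by (auto simp: double_diff)
    then have "D = E \<union> T" using * by auto
    ultimately show False using c * D unfolding ET by (auto simp: down_cubes_def cubes_def)
  qed
qed

text \<open>This is \<open>exact_up\<close> in the dual complex, for the complements of the sets in
  \<open>L\<close>: intersections become unions, and removing an element becomes adding one.\<close>

lemma exact_down:
  assumes LP: "L \<subseteq> Pow P" and Lint: "\<And>D E. D \<in> L \<Longrightarrow> E \<in> L \<Longrightarrow> D \<inter> E \<in> L"
    and sep: "\<And>D E. D \<in> L \<Longrightarrow> E \<in> L \<Longrightarrow> \<not> D \<subseteq> E \<Longrightarrow> \<exists>t\<in>D - E. D - {t} \<in> L"
    and FL: "F \<subseteq> L" and Fdown: "\<And>E D. D \<in> F \<Longrightarrow> E \<in> L \<Longrightarrow> E \<subseteq> D \<Longrightarrow> E \<in> F"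
  shows "exact (down_cubes L F)"
  unfolding exact_def
proof (intro ballI impI)
  interpret D: cube_complex R P sg y x "\<lambda>E. u (P - E)" by (rule dual)
  fix z assume z: "z \<in> chains (down_cubes L F)" "delta z = (\<lambda>_. 0)" "aug z = 0"
  have "D.exact (D.up_cubes ((-) P ` L) ((-) P ` F))"
  proof (rule D.exact_up)
    show "D \<union> E \<in> (-) P ` L" if "D \<in> (-) P ` L" "E \<in> (-) P ` L" for D E
      using that Lint by (auto simp: Diff_Int[symmetric])
    show "\<exists>t\<in>D - E. insert t E \<in> (-) P ` L" if prem: "D \<in> (-) P ` L" "E \<in> (-) P ` L" "\<not> D \<subseteq> E" for D E
    proof -
      obtain D' E' where *: "D' \<in> L" "E' \<in> L" "D = P - D'" "E = P - E'" using prem(1,2) by blast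
      then have "\<not> E' \<subseteq> D'" using prem(3) by auto
      then obtain t where t: "t \<in> E' - D'" "E' - {t} \<in> L" using sep * by blast
      then have "insert t E = P - (E' - {t})" "t \<in> D - E" using * LP by auto
      then show ?thesis using t by blast
    qed
    show "D \<in> (-) P ` F" if prem: "E \<in> (-) P ` F" "D \<in> (-) P ` L" "E \<subseteq> D" for E D
    proof -
      obtain D' E' where *: "D' \<in> L" "E' \<in> F" "D = P - D'" "E = P - E'" using prem(1,2) by blast
      then have "D' \<subseteq> E'" using prem(3) LP FL by auto
      then show ?thesis using Fdown * by blast
    qed
  qed (use LP FL in auto)
  moreover have cub: "cubes L \<subseteq> cubes (Pow P)" if "L \<subseteq> Pow P" for L unfolding cubes_def using that by auto
  have zc: "z \<in> chains (cubes (Pow P))"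
    using z(1) by (rule chains_mono) (use cub[OF LP] in \<open>auto simp: down_cubes_def\<close>)
  have "D.delta (flip z) = (\<lambda>_. 0)"
    unfolding flip_delta[OF zc] z(2) by (auto simp: flip_def)
  moreover have "D.aug (flip z) = 0" using flip_aug z(3) unfolding D.aug_def by simp
  ultimately obtain w where w: "w \<in> chains (up_cubes ((-) P ` L) ((-) P ` F))" "D.delta w = flip z"
    using flip_chains[OF z(1)] unfolding D.exact_def by auto
  have "up_cubes ((-) P ` L) ((-) P ` F) \<subseteq> cubes (Pow P)"
    using cub[of "(-) P ` L"] by (auto simp: up_cubes_def)
  then have "w \<in> chains (cubes (Pow P))" using chains_mono w(1) by blast
  from D.flip_delta[OF this] have "delta (D.flip w) = D.flip (D.delta w)" .
  then have "delta (flip w) = z" using w(2) flip_flip[OF zc] by simp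
  then show "\<exists>w\<in>chains (down_cubes L F). delta w = z"
    using flip_chains'[OF w(1) LP FL] by blast
qed

end

section \<open>The relative complex\<close>

context cube_complex begin

lemma aug_uminus: "aug (\<lambda>c. - z c) = - aug z"
  by (simp add: aug_def sum_negf)

definition res :: "'p cell set \<Rightarrow> ('p cell \<Rightarrow> 'r) \<Rightarrow> 'p cell \<Rightarrow> 'r" where
  "res X z c = (if c \<in> X then z c else 0)"

lemma aug_in_R: "z \<in> chains X \<Longrightarrow> aug z \<in> R"
  unfolding aug_def by (intro Rsum Rmult uR) (auto simp: chains_def)

lemma res_chains: "(\<And>c. z c \<in> R) \<Longrightarrow> res X z \<in> chains X"
  by (rule chainsI) (auto simp: res_def)

lemma delta_omit_vertices:
  assumes "\<And>E T. T \<noteq> {} \<Longrightarrow> z (E, T) = w (E, T)"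
  shows "delta z = delta w"
  by (rule ext) (auto simp: delta_def assms split: prod.splits)

lemma exact_no_vertices:
  assumes "exact X" "z \<in> chains X" "delta z = (\<lambda>_. 0)" "aug z = 0"
  obtains w where "w \<in> chains X" "\<And>E. w (E, {}) = 0" "delta w = z"
proof -
  obtain w where w: "w \<in> chains X" "delta w = z"
    using assms unfolding exact_def by blast
  define w' where "w' = res {c. snd c \<noteq> {}} w"
  have "w' \<in> chains X"
    unfolding w'_def by (rule chainsI) (auto simp: res_def chainsD[OF w(1)])
  moreover have "w' (E, {}) = 0" for E by (simp add: w'_def res_def)
  moreover have "delta w' = z"
    unfolding w(2)[symmetric] by (rule delta_omit_vertices) (simp add: w'_def res_def)
  ultimately show thesis using that by blast
qed

end

text \<open>Chains on \<open>XR\<close> with the differential \<open>res XR\<close> after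
  \<open>delta\<close> form the quotient of the complex on \<open>XL\<close> by the direct sum of
  those on \<open>XI\<close> and \<open>XJ\<close>. The connecting map of the long exact sequence is
  \<open>z \<mapsto> aug (res XI (delta z))\<close>, and the lemmas below carry out that sequence by
  diagram chasing.\<close>

locale relative_complex = cube_complex R P sg x y u
  for R :: "'r::comm_ring_1 set" and P :: "'p set" and sg x y u +
  fixes XI XJ XL XR :: "('p set \<times> 'p set) set"
  assumes fI: "face_closed XI" and fJ: "face_closed XJ" and fL: "face_closed XL"
    and exactI: "exact XI" and exactJ: "exact XJ" and exactL: "exact XL"
    and XL: "XL = XI \<union> XJ \<union> XR" and disj: "XI \<inter> XJ = {}" "XI \<inter> XR = {}" "XJ \<inter> XR = {}"
    and vertices: "(E, {}) \<notin> XR" and cells: "XR \<subseteq> Pow P \<times> Pow P"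
begin

lemma disjoint: "c \<in> XR \<Longrightarrow> c \<notin> XI" "c \<in> XR \<Longrightarrow> c \<notin> XJ" "c \<in> XI \<Longrightarrow> c \<notin> XJ"
  using disj by auto

lemma chains_split:
  assumes "z \<in> chains XL"
  shows "z c = res XI z c + res XJ z c + res XR z c"
  using assms chainsD(2)[OF assms, of c] disj unfolding res_def XL by auto

text \<open>Boundaries do not leave the face-closed sets \<open>XI\<close> and \<open>XJ\<close>. So
  cells of \<open>XJ\<close> add nothing on \<open>XI\<close>, and only cells of \<open>XR\<close>
  contribute on \<open>XR\<close>.\<close>

lemma res_delta_split:
  assumes "w \<in> chains XL"
  shows "res XI (delta w) c = delta (res XI w) c + res XI (delta (res XR w)) c"
    and "res XR (delta w) c = res XR (delta (res XR w)) c"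
proof -
  have r: "res X w \<in> chains X" for X
    by (rule res_chains) (rule chainsD(1)[OF assms])
  have w: "w = (\<lambda>c. res XI w c + res XJ w c + res XR w c)"
    by (rule ext) (rule chains_split[OF assms])
  have d: "delta w c = delta (res XI w) c + delta (res XJ w) c + delta (res XR w) c" for c
    using arg_cong[OF w, of "\<lambda>z. delta z c"] unfolding delta_add .
  have "c \<notin> XI \<Longrightarrow> delta (res XI w) c = 0" "c \<notin> XJ \<Longrightarrow> delta (res XJ w) c = 0"
    using chainsD(2)[OF delta_chains[OF fI r]] chainsD(2)[OF delta_chains[OF fJ r]] by blast+
  then show "res XI (delta w) c = delta (res XI w) c + res XI (delta (res XR w)) c"
    "res XR (delta w) c = res XR (delta (res XR w)) c"
    using disjoint[of c] d[of c] by (auto simp: res_def)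
qed

lemma chains_sub: "z \<in> chains XI \<Longrightarrow> z \<in> chains XL" "z \<in> chains XJ \<Longrightarrow> z \<in> chains XL"
   "z \<in> chains XR \<Longrightarrow> z \<in> chains XL"
  by (auto intro: chains_mono simp: XL)

lemma aug_res_R: "aug (res XR z) = 0"
  using vertices by (simp add: aug_def res_def)

text \<open>As \<open>aug (delta z) = 0\<close> and \<open>XR\<close> has no vertices, the parts of
  \<open>delta z\<close> in \<open>XI\<close> and \<open>XJ\<close> have opposite augmentations.
  Hence the connecting map takes its values in both ideals.\<close>

lemma delta_parts_R:
  assumes z: "z \<in> chains XR"
  shows "res X (delta z) \<in> chains X"
    "delta z c = res XI (delta z) c + res XJ (delta z) c + res XR (delta z) c"
    "aug (res XI (delta z)) = - aug (res XJ (delta z))"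
proof -
  show "res X (delta z) \<in> chains X"
    by (rule res_chains, rule delta_in_R, rule chainsD(1)[OF z])
  have *: "delta z c = res XI (delta z) c + res XJ (delta z) c + res XR (delta z) c" for c
    using chains_split delta_chains fL chains_sub(3)[OF z] by blast
  show "delta z c = res XI (delta z) c + res XJ (delta z) c + res XR (delta z) c" by (rule *)
  have "aug (delta z) = aug (\<lambda>c. res XI (delta z) c + res XJ (delta z) c + res XR (delta z) c)"
    using ext[OF *] by (rule arg_cong)
  also have "\<dots> = aug (res XI (delta z)) + aug (res XJ (delta z))"
    by (simp add: aug_add aug_res_R)
  finally show "aug (res XI (delta z)) = - aug (res XJ (delta z))"
    unfolding aug_delta eq_neg_iff_add_eq_0 by (rule sym)
qed

text \<open>The two halves of \<open>delta z\<close> in \<open>XI\<close> and \<open>XJ\<close> are cycles, hence boundaries there; correcting \<open>z\<close> by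
  them gives a cycle of the full complex.\<close>
lemma relative_cycle:
  assumes z: "z \<in> chains XR" and R: "res XR (delta z) = (\<lambda>_. 0)" and a: "aug (res XI (delta z)) = 0"
  shows "\<exists>w\<in>chains XR. res XR (delta w) = z"
proof -
  let ?i = "res XI (delta z)" and ?j = "res XJ (delta z)"
  note i = delta_parts_R(1)[OF z, of XI] and j = delta_parts_R(1)[OF z, of XJ]
  have dz: "delta z = (\<lambda>c. ?i c + ?j c)"
    using delta_parts_R(2)[OF z] R by auto
  have sum0: "delta ?i c + delta ?j c = 0" for c
    using delta_delta[of z c] unfolding delta_add[symmetric] dz[symmetric] .
  \<comment> \<open>The two boundaries are supported in the disjoint sets \<open>XI\<close> and
    \<open>XJ\<close>, so they vanish separately.\<close>
  have "delta ?i c = 0 \<and> delta ?j c = 0" for c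
    using sum0[of c] disj(1) chainsD(2)[OF delta_chains[OF fI i], of c]
      chainsD(2)[OF delta_chains[OF fJ j], of c] by fastforce
  then have "delta ?i = (\<lambda>_. 0)" "delta ?j = (\<lambda>_. 0)" by auto
  moreover have "aug ?j = 0" using delta_parts_R(3)[OF z] a by simp
  ultimately obtain wi wj where
    wi: "wi \<in> chains XI" "\<And>E. wi (E, {}) = 0" "delta wi = ?i" and
    wj: "wj \<in> chains XJ" "\<And>E. wj (E, {}) = 0" "delta wj = ?j"
    using exact_no_vertices exactI exactJ i j a by metis
  let ?z = "\<lambda>c. z c - wi c - wj c"
  have "?z \<in> chains XL" 
    by (rule chains_diff[OF chains_diff[OF chains_sub(3)[OF z] chains_sub(1)[OF wi(1)]] chains_sub(2)[OF wj(1)]])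
  moreover have "delta ?z = (\<lambda>_. 0)"
    by (rule ext) (simp only: delta_diff delta_add wi wj diff_diff_eq right_minus_eq fun_cong[OF dz, symmetric])
  moreover have "aug ?z = 0"
    using vertices chainsD(2)[OF z] by (simp add: aug_def wi wj)
  ultimately obtain w where w: "w \<in> chains XL" "delta w = ?z"
    using exactL unfolding exact_def by blast
  have "res XR (delta (res XR w)) = z"
  proof
    fix c
    have "wi c = 0 \<and> wj c = 0" if "c \<in> XR"
      using disjoint(1,2)[OF that] chainsD(2)[OF wi(1), of c] chainsD(2)[OF wj(1), of c] by auto
    then show "res XR (delta (res XR w)) c = z c"
      unfolding res_delta_split(2)[OF w(1), symmetric] w(2)
      using chainsD(2)[OF z, of c] by (auto simp: res_def)
  qed
  then show ?thesis using res_chains chainsD(1)[OF w(1)] by blast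
qed

text \<open>By d d = 0, \<open>delta z\<close> is minus the boundaries of the \<open>XI\<close> and
  \<open>XJ\<close> parts of \<open>delta w\<close>. These boundaries stay in \<open>XI\<close> and
  \<open>XJ\<close>, and \<open>aug\<close> kills them.\<close>

lemma relative_boundary:
  assumes w: "w \<in> chains XR" and z: "z = res XR (delta w)"
  shows "res XR (delta z) = (\<lambda>_. 0)" and "aug (res XI (delta z)) = 0"
proof -
  let ?i = "res XI (delta w)" and ?j = "res XJ (delta w)"
  note i = delta_parts_R(1)[OF w, of XI] and j = delta_parts_R(1)[OF w, of XJ]
  have dw: "delta w = (\<lambda>c. ?i c + ?j c + z c)"
    using delta_parts_R(2)[OF w] z by auto
  have "delta ?i c + delta ?j c + delta z c = 0" for c
    using delta_delta[of w c] unfolding delta_add[symmetric] dw[symmetric] .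
  then have eq: "delta z c = - delta ?i c - delta ?j c" for c
    by (metis add.commute add_diff_cancel_right' diff_0 diff_add_eq_diff_diff_swap)
  have zi: "delta ?i c = 0" if "c \<notin> XI" for c using that chainsD(2)[OF delta_chains[OF fI i]] by blast
  have zj: "delta ?j c = 0" if "c \<notin> XJ" for c using that chainsD(2)[OF delta_chains[OF fJ j]] by blast
  show "res XR (delta z) = (\<lambda>_. 0)"
    by (rule ext) (simp add: res_def eq zi zj disjoint)
  have "res XI (delta z) = (\<lambda>c. - delta ?i c)"
    by (rule ext) (simp add: res_def eq zi zj disjoint)
  then show "aug (res XI (delta z)) = 0" by (simp only: aug_uminus aug_delta neg_0_equal_iff_equal minus_zero)
qed

text \<open>If \<open>aug a = aug b\<close> with \<open>a\<close> on \<open>XI\<close> and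
  \<open>b\<close> on \<open>XJ\<close>, both made of vertices, then \<open>a - b\<close> bounds
  some \<open>w\<close> on all cells. The part of \<open>w\<close> in \<open>XR\<close> is the
  wanted chain: \<open>a\<close> is the \<open>XI\<close> part of its boundary, up to a boundary
  inside \<open>XI\<close>.\<close>

lemma relative_image:
  "aug ` chains XI \<inter> aug ` chains XJ = (\<lambda>z. aug (res XI (delta z))) ` chains XR"
proof (intro equalityI subsetI)
  fix f assume "f \<in> (\<lambda>z. aug (res XI (delta z))) ` chains XR"
  then obtain z where z: "z \<in> chains XR" "f = aug (res XI (delta z))" by blast
  have "f = aug (\<lambda>c. - res XJ (delta z) c)"
    using delta_parts_R(3)[OF z(1)] z(2) by (simp only: aug_uminus)
  moreover have "(\<lambda>c. - res XJ (delta z) c) \<in> chains XJ"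
    using delta_parts_R(1)[OF z(1), of XJ] by (intro chainsI) (auto dest: chainsD)
  ultimately show "f \<in> aug ` chains XI \<inter> aug ` chains XJ"
    using z delta_parts_R(1)[OF z(1), of XI] by blast
next
  fix f assume "f \<in> aug ` chains XI \<inter> aug ` chains XJ"
  then obtain a b where ab: "a \<in> chains XI" "f = aug a" "b \<in> chains XJ" "f = aug b" by blast
  define a' where "a' = res {c. snd c = {}} a"
  define b' where "b' = res {c. snd c = {}} b"
  have ab': "a' \<in> chains XI" "f = aug a'" "b' \<in> chains XJ" "f = aug b'"
    using ab unfolding a'_def b'_def
    by (auto simp: aug_def res_def intro!: chainsI dest: chainsD)
  have no: "E \<noteq> {} \<Longrightarrow> a' (D, E) = 0 \<and> b' (D, E) = 0" for D E
    unfolding a'_def b'_def by (simp add: res_def)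
  have "(\<lambda>c. a' c - b' c) \<in> chains XL" 
    by (rule chains_diff[OF chains_sub(1)[OF ab'(1)] chains_sub(2)[OF ab'(3)]])
  moreover have "delta (\<lambda>c. a' c - b' c) = delta (\<lambda>_. 0)"
    by (rule delta_omit_vertices) (simp add: no)
  then have "delta (\<lambda>c. a' c - b' c) = (\<lambda>_. 0)" using delta_zero by auto
  moreover have "aug (\<lambda>c. a' c - b' c) = 0" using ab' by (simp add: aug_diff)
  ultimately obtain w where w: "w \<in> chains XL" "delta w = (\<lambda>c. a' c - b' c)"
    using exactL unfolding exact_def by blast
  have "a' c = delta (res XI w) c + res XI (delta (res XR w)) c" for c
    unfolding res_delta_split(1)[OF w(1), symmetric] w(2)
    using disj(1) chainsD(2)[OF ab'(1), of c] chainsD(2)[OF ab'(3), of c] by (auto simp: res_def)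
  then have "a' = (\<lambda>c. delta (res XI w) c + res XI (delta (res XR w)) c)" by blast
  from arg_cong[OF this, of aug] have "aug a' = aug (delta (res XI w)) + aug (res XI (delta (res XR w)))"
    unfolding aug_add .
  then have "f = aug (res XI (delta (res XR w)))" using ab'(2) aug_delta by simp
  moreover have "res XR w \<in> chains XR" using res_chains chainsD(1)[OF w(1)] by blast
  ultimately show "f \<in> (\<lambda>z. aug (res XI (delta z))) ` chains XR" by blast
qed

section \<open>Separating the dimensions of the relative complex\<close>

text \<open>\<open>XR\<close> has no vertices, so homological degree \<open>i\<close> holds the
  cells of dimension \<open>i + 1\<close>.\<close>

definition layer :: "nat \<Rightarrow> ('p set \<times> 'p set) set" where
  "layer i = {c \<in> XR. card (snd c) = Suc i}"

lemma layer_XR: "layer i \<subseteq> XR"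
  by (auto simp: layer_def)

lemma finite_XR: "finite XR"
  using cells by (rule finite_subset) simp

lemma finite_layer: "finite (layer i)"
  using finite_subset[OF layer_XR finite_XR] .

lemma finite_snd: "c \<in> XR \<Longrightarrow> finite (snd c)"
  using cells finite_subset[OF _ finP] by (cases c) auto

lemma delta_size:
  assumes "finite (snd c)" "\<And>c'. card (snd c') = Suc (card (snd c)) \<Longrightarrow> z c' = w c'"
  shows "delta z c = delta w c"
proof (cases c)
  case (Pair E T)
  have "z (E - {t}, insert t T) = w (E - {t}, insert t T)" if "t \<in> P - T" for t
    using assms that Pair by auto
  then show ?thesis unfolding Pair delta_def by simp
qed

lemma delta_size_0:
  assumes "finite (snd c)" "\<And>c'. card (snd c') = Suc (card (snd c)) \<Longrightarrow> z c' = 0"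
  shows "delta z c = 0"
  using delta_size[of c z "\<lambda>_. 0"] assms by (simp add: delta_zero)

lemma layer_delta_other:
  assumes "z \<in> chains (layer (Suc i))" "c \<in> XR" "c \<notin> layer i"
  shows "delta z c = 0"
proof (rule delta_size_0)
  show "z c' = 0" if "card (snd c') = Suc (card (snd c))" for c'
    using chainsD(2)[OF assms(1), of c'] that assms(2,3) by (auto simp: layer_def)
qed (rule finite_snd[OF assms(2)])

lemma layer_0_delta_other:
  assumes "z \<in> chains (layer 0)" "c \<in> XR"
  shows "delta z c = 0"
proof (rule delta_size_0)
  have "snd c \<noteq> {}" using vertices assms(2) by (cases c) auto
  then show "z c' = 0" if "card (snd c') = Suc (card (snd c))" for c'
    using chainsD(2)[OF assms(1), of c'] that finite_snd[OF assms(2)] by (auto simp: layer_def)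
qed (rule finite_snd[OF assms(2)])

text \<open>Cells of dimension at least 2 have no vertices among their facets.\<close>

lemma layer_aug:
  assumes "z \<in> chains (layer (Suc i))"
  shows "aug (res XI (delta z)) = 0"
proof -
  have *: "delta z (E, {}) = 0" for E
    by (rule delta_size_0) (auto simp: layer_def chainsD(2)[OF assms])
  have "res XI (delta z) (E, {}) = 0" for E using *[of E] by (simp add: res_def)
  then show ?thesis unfolding aug_def by simp
qed

text \<open>\<open>relative_cycle\<close> yields a preimage of mixed dimensions. Only its cells in
  \<open>layer (Suc i)\<close> can contribute on \<open>layer i\<close>, so the others are cut
  away.\<close>

lemma layer_boundary:
  assumes "z \<in> chains (layer i)" "res XR (delta w) = z" "w \<in> chains XR"
  shows "\<exists>w\<in>chains (layer (Suc i)). \<forall>c\<in>layer i. delta w c = z c"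
proof (intro bexI ballI)
  show "res (layer (Suc i)) w \<in> chains (layer (Suc i))"
    by (rule res_chains) (rule chainsD(1)[OF assms(3)])
  fix c assume c: "c \<in> layer i"
  then have cR: "c \<in> XR" using layer_XR by blast
  have "delta (res (layer (Suc i)) w) c = delta w c"
  proof (rule delta_size)
    show "res (layer (Suc i)) w c' = w c'" if "card (snd c') = Suc (card (snd c))" for c'
      using chainsD(2)[OF assms(3), of c'] that c by (auto simp: layer_def res_def)
  qed (rule finite_snd[OF cR])
  also have "\<dots> = z c" using assms(2) cR by (auto simp: res_def)
  finally show "delta (res (layer (Suc i)) w) c = z c" .
qed

lemma layer_chains_XR: "z \<in> chains (layer i) \<Longrightarrow> z \<in> chains XR"
  using chains_mono layer_XR by blast

lemma layer_res:
  assumes "w \<in> chains (layer (Suc i))" "z \<in> chains (layer i)" "\<forall>c\<in>layer i. delta w c = z c"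
  shows "z = res XR (delta w)"
proof
  fix c
  show "z c = res XR (delta w) c"
    using assms(3) layer_delta_other[OF assms(1), of c] chainsD(2)[OF assms(2), of c] layer_XR[of i]
    by (cases "c \<in> layer i") (auto simp: res_def)
qed

lemma layer_exact_0:
  assumes z: "z \<in> chains (layer 0)"
  shows "aug (res XI (delta z)) = 0 \<longleftrightarrow> (\<exists>w\<in>chains (layer 1). \<forall>c\<in>layer 0. delta w c = z c)"
proof
  assume "aug (res XI (delta z)) = 0"
  moreover have "res XR (delta z) = (\<lambda>_. 0)"
    by (rule ext) (auto simp: res_def layer_0_delta_other[OF z])
  ultimately obtain w where "w \<in> chains XR" "res XR (delta w) = z"
    using relative_cycle layer_chains_XR[OF z] by blast
  then show "\<exists>w\<in>chains (layer 1). \<forall>c\<in>layer 0. delta w c = z c"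
    using layer_boundary[OF z] by simp
next
  assume "\<exists>w\<in>chains (layer 1). \<forall>c\<in>layer 0. delta w c = z c"
  then obtain w where w: "w \<in> chains (layer (Suc 0))" "\<forall>c\<in>layer 0. delta w c = z c" by auto
  show "aug (res XI (delta z)) = 0"
    by (rule relative_boundary(2)[OF layer_chains_XR[OF w(1)] layer_res[OF w(1) z w(2)]])
qed

lemma layer_exact_Suc:
  assumes z: "z \<in> chains (layer (Suc i))"
  shows "(\<forall>c\<in>layer i. delta z c = 0) \<longleftrightarrow>
    (\<exists>w\<in>chains (layer (Suc (Suc i))). \<forall>c\<in>layer (Suc i). delta w c = z c)"
proof
  assume "\<forall>c\<in>layer i. delta z c = 0"
  then have "res XR (delta z) = (\<lambda>_. 0)"
    using layer_delta_other[OF z] by (intro ext) (auto simp: res_def)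
  then obtain w where "w \<in> chains XR" "res XR (delta w) = z"
    using relative_cycle layer_chains_XR[OF z] layer_aug[OF z] by blast
  then show "\<exists>w\<in>chains (layer (Suc (Suc i))). \<forall>c\<in>layer (Suc i). delta w c = z c"
    using layer_boundary[OF z] by simp
next
  assume "\<exists>w\<in>chains (layer (Suc (Suc i))). \<forall>c\<in>layer (Suc i). delta w c = z c"
  then obtain w where w: "w \<in> chains (layer (Suc (Suc i)))" "\<forall>c\<in>layer (Suc i). delta w c = z c" by auto
  have *: "res XR (delta z) = (\<lambda>_. 0)"
    by (rule relative_boundary(1)[OF layer_chains_XR[OF w(1)] layer_res[OF w(1) z w(2)]])
  show "\<forall>c\<in>layer i. delta z c = 0"
  proof
    fix c assume "c \<in> layer i"
    then show "delta z c = 0"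
      using fun_cong[OF *, of c] layer_XR[of i] by (auto simp: res_def)
  qed
qed

text \<open>\<open>aug\<close> sees only vertices, and a vertex is a facet of edges only, so the
  edges in \<open>XR\<close> already give the whole image.\<close>

lemma layer_image:
  "aug ` chains XI \<inter> aug ` chains XJ = (\<lambda>z. aug (res XI (delta z))) ` chains (layer 0)"
  unfolding relative_image
proof (intro equalityI image_subsetI)
  fix z assume z: "z \<in> chains XR"
  have *: "delta (res (layer 0) z) (E, {}) = delta z (E, {})" for E
  proof (rule delta_size)
    show "res (layer 0) z c' = z c'" if "card (snd c') = Suc (card (snd (E, {})))" for c'
      using chainsD(2)[OF z, of c'] that by (auto simp: layer_def res_def)
  qed simp
  have "aug (res XI (delta z)) = aug (res XI (delta (res (layer 0) z)))"
    unfolding aug_def by (intro sum.cong) (auto simp: res_def[of XI] *)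
  moreover have "res (layer 0) z \<in> chains (layer 0)"
    by (rule res_chains) (rule chainsD(1)[OF z])
  ultimately show "aug (res XI (delta z)) \<in> (\<lambda>z. aug (res XI (delta z))) ` chains (layer 0)"
    by blast
qed (use layer_chains_XR in blast)

section \<open>Matrix entries of the differential\<close>

definition unit_cell :: "'p set \<times> 'p set \<Rightarrow> 'p set \<times> 'p set \<Rightarrow> 'r" where
  "unit_cell c c' = (if c' = c then 1 else 0)"

lemma chain_sum:
  assumes "finite X" "z \<in> chains X"
  shows "z = (\<lambda>c'. \<Sum>c\<in>X. z c * unit_cell c c')"
proof
  fix c'
  have "(\<Sum>c\<in>X. z c * unit_cell c c') = (\<Sum>c\<in>X. if c' = c then z c else 0)"
    by (intro sum.cong) (auto simp: unit_cell_def)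
  also have "\<dots> = z c'" using assms(1) chainsD(2)[OF assms(2), of c'] by simp
  finally show "z c' = (\<Sum>c\<in>X. z c * unit_cell c c')" by simp
qed

lemma delta_sum: "delta (\<lambda>c. \<Sum>i\<in>A. f i c) c = (\<Sum>i\<in>A. delta (f i) c)"
  by (cases c) (simp add: delta_def sum_distrib_left, rule sum.swap)

lemma aug_sum: "aug (\<lambda>c. \<Sum>i\<in>A. f i c) = (\<Sum>i\<in>A. aug (f i))"
  by (simp add: aug_def sum_distrib_right, rule sum.swap)

lemma delta_chain:
  assumes "finite X" "z \<in> chains X"
  shows "delta z c' = (\<Sum>c\<in>X. delta (unit_cell c) c' * z c)"
  using arg_cong[OF chain_sum[OF assms], of "\<lambda>z. delta z c'"]
  unfolding delta_sum delta_scale by (simp only: mult.commute)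

lemma aug_delta_chain:
  assumes "finite X" "z \<in> chains X"
  shows "aug (res Y (delta z)) = (\<Sum>c\<in>X. z c * aug (res Y (delta (unit_cell c))))"
proof -
  have "res Y (delta z) = (\<lambda>c'. \<Sum>c\<in>X. z c * res Y (delta (unit_cell c)) c')"
    by (rule ext) (simp add: res_def delta_chain[OF assms] mult.commute)
  then show ?thesis by (simp only: aug_sum aug_scale)
qed

end

section \<open>Polynomials\<close>

lemma keys_add_nat: "Poly_Mapping.keys (a + b :: 'v \<Rightarrow>\<^sub>0 nat) = Poly_Mapping.keys a \<union> Poly_Mapping.keys b"
  by (auto simp: in_keys_iff lookup_add)

lemma mdeg_superset:
  assumes "finite A" "Poly_Mapping.keys m \<subseteq> A"
  shows "mdeg m = (\<Sum>v\<in>A. Poly_Mapping.lookup m v)"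
  unfolding mdeg_def by (rule sum.mono_neutral_left) (use assms in \<open>auto simp: in_keys_iff\<close>)

lemma mdeg_add: "mdeg (a + b) = mdeg a + mdeg b"
proof -
  let ?A = "Poly_Mapping.keys a \<union> Poly_Mapping.keys b"
  have "mdeg c = (\<Sum>v\<in>?A. Poly_Mapping.lookup c v)" if "c \<in> {a, b, a + b}" for c
    by (rule mdeg_superset) (use that in \<open>auto simp: keys_add_nat\<close>)
  then show ?thesis by (simp add: lookup_add sum.distrib)
qed

lemma homog_0 [simp]: "homog k 0"
  by (simp add: homog_def)

lemma homog_1: "homog 0 1"
  by (simp add: homog_def mdeg_def)

lemma homog_add: "homog k f \<Longrightarrow> homog k g \<Longrightarrow> homog k (f + g)"
  unfolding homog_def using Poly_Mapping.keys_add[of f g] by blast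

lemma homog_uminus: "homog k f \<Longrightarrow> homog k (- f)"
  unfolding homog_def by (auto simp: in_keys_iff)

lemma homog_sum: "(\<And>i. i \<in> A \<Longrightarrow> homog k (f i)) \<Longrightarrow> homog k (\<Sum>i\<in>A. f i)"
  by (induction A rule: infinite_finite_induct) (auto intro: homog_add)

lemma homog_mult: "homog j f \<Longrightarrow> homog k g \<Longrightarrow> homog (j + k) (f * g)"
  unfolding homog_def using keys_mult[of f g] by (fastforce simp: mdeg_add)

lemma homog_Var: "homog 1 (Var v)"
  by (auto simp: homog_def Var_def mdeg_def)

lemma homog_prod_Var:
  "finite A \<Longrightarrow> homog (card A) (\<Prod>p\<in>A. Var (w p))"
proof (induction A rule: finite_induct)
  case empty
  then show ?case by (simp add: homog_1)
next
  case (insert a A)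
  then show ?case using homog_mult[OF homog_Var, of "card A" _ "w a"] by simp
qed

interpretation polyring: ring_subset "polyring V"
proof
  show "0 \<in> polyring V" "1 \<in> polyring V" by (auto simp: polyring_def)
  fix f g :: "('a, 'b) mpoly"
  assume f: "f \<in> polyring V"
  then show "- f \<in> polyring V" by (simp add: polyring_def in_keys_iff)
  assume g: "g \<in> polyring V"
  show "f + g \<in> polyring V"
    using f g Poly_Mapping.keys_add[of f g] unfolding polyring_def by blast
  show "f * g \<in> polyring V"
    using f g keys_mult[of f g] unfolding polyring_def by (fastforce simp: keys_add_nat)
qed

lemma Var_polyring: "v \<in> V \<Longrightarrow> Var v \<in> polyring V"
  by (simp add: polyring_def Var_def)

lemma Var_single: "Poly_Mapping.single (Poly_Mapping.single v (Suc 0)) 1 = Var v"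
  by (simp add: Var_def)

lemma lookup_mult_single_add:
  fixes f :: "('v, 'k::comm_ring_1) mpoly"
  shows "Poly_Mapping.lookup (f * Poly_Mapping.single m c) (k + m) = Poly_Mapping.lookup f k * c"
proof -
  have "(\<Sum>q. Poly_Mapping.lookup (Poly_Mapping.single m c) q when k + m = l + q) = (c when l = k)" for l
  proof -
    have "(\<lambda>q. Poly_Mapping.lookup (Poly_Mapping.single m c) q when k + m = l + q)
        = (\<lambda>q. (c when l = k) when q = m)"
      by (rule ext) (auto simp: lookup_single when_def)
    then have "(\<Sum>q. Poly_Mapping.lookup (Poly_Mapping.single m c) q when k + m = l + q)
        = (\<Sum>q. (c when l = k) when q = m)" by (rule arg_cong)
    also have "\<dots> = (c when l = k)" by (rule Sum_any_when_equal)
    finally show ?thesis .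
  qed
  then show ?thesis by (simp add: lookup_mult mult_when)
qed

lemma monomial_sum:
  "f = (\<Sum>m\<in>Poly_Mapping.keys f. Poly_Mapping.single m (Poly_Mapping.lookup f m))"
proof (rule poly_mapping_eqI)
  fix k
  have "Poly_Mapping.lookup (\<Sum>m\<in>Poly_Mapping.keys f. Poly_Mapping.single m (Poly_Mapping.lookup f m)) k
      = (\<Sum>m\<in>Poly_Mapping.keys f. if m = k then Poly_Mapping.lookup f m else 0)"
    unfolding lookup_sum by (intro sum.cong) (auto simp: lookup_single when_def)
  then show "Poly_Mapping.lookup f k = Poly_Mapping.lookup
      (\<Sum>m\<in>Poly_Mapping.keys f. Poly_Mapping.single m (Poly_Mapping.lookup f m)) k"
    by (simp add: in_keys_iff)
qed

text \<open>An ideal generated by variables is a monomial ideal, so membership is decided monomial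
  by monomial. The factor \<open>\<eta>\<close> stands for a sign and lets \<open>x_t\<close> and
  \<open>- y_t\<close> be handled at once.\<close>

lemma lincomb_Var_iff:
  fixes f :: "('v, 'k::comm_ring_1) mpoly" and \<eta> :: "('v, 'k) mpoly"
  assumes fin: "finite M" and wV: "w ` M \<subseteq> V" and \<eta>: "\<eta> * \<eta> = 1" "\<eta> \<in> polyring V"
  shows "f \<in> lincomb (polyring V) (\<lambda>t. \<eta> * Var (w t)) M \<longleftrightarrow>
    f \<in> polyring V \<and> (\<forall>m\<in>Poly_Mapping.keys f. \<exists>t\<in>M. w t \<in> Poly_Mapping.keys m)"
proof safe
  assume "f \<in> lincomb (polyring V) (\<lambda>t. \<eta> * Var (w t)) M"
  then obtain c where c: "f = (\<Sum>t\<in>M. c t * (\<eta> * Var (w t)))" "\<And>t. c t \<in> polyring V"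
    unfolding lincomb_def by blast
  show "f \<in> polyring V"
    unfolding c(1) using wV by (intro polyring.Rsum polyring.Rmult c(2) \<eta>(2) Var_polyring) auto
  fix m assume "m \<in> Poly_Mapping.keys f"
  then obtain t where t: "t \<in> M" "m \<in> Poly_Mapping.keys ((c t * \<eta>) * Var (w t))"
    unfolding c(1) using keys_sum[of "\<lambda>t. c t * (\<eta> * Var (w t))" M] by (auto simp: mult.assoc)
  then obtain a where "m = a + Poly_Mapping.single (w t) 1"
    using keys_mult[of "c t * \<eta>" "Var (w t)"] by (auto simp: Var_def split: if_splits)
  then show "\<exists>t\<in>M. w t \<in> Poly_Mapping.keys m" using t(1) by (auto simp: keys_add_nat)
next
  assume f: "f \<in> polyring V" and hit: "\<forall>m\<in>Poly_Mapping.keys f. \<exists>t\<in>M. w t \<in> Poly_Mapping.keys m"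
  have "Poly_Mapping.single m (Poly_Mapping.lookup f m) \<in> lincomb (polyring V) (\<lambda>t. \<eta> * Var (w t)) M"
    if m: "m \<in> Poly_Mapping.keys f" for m
  proof -
    obtain t where t: "t \<in> M" "w t \<in> Poly_Mapping.keys m" using hit m by blast
    \<comment> \<open>Division of the monomial by the variable \<open>w t\<close>; the truncated
      subtraction is exact because \<open>w t\<close> occurs in \<open>m\<close>.\<close>
    define m' where "m' = m - Poly_Mapping.single (w t) 1"
    have mm: "m = m' + Poly_Mapping.single (w t) 1"
      by (rule poly_mapping_eqI)
        (use t(2) in \<open>auto simp: m'_def lookup_add lookup_minus lookup_single when_def in_keys_iff\<close>)
    define a where "a = Poly_Mapping.single m' (Poly_Mapping.lookup f m) * \<eta>"
    have "Poly_Mapping.keys m' \<subseteq> Poly_Mapping.keys m"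
      by (subst mm) (auto simp: keys_add_nat)
    then have "Poly_Mapping.keys m' \<subseteq> V"
      using f m unfolding polyring_def by blast
    then have aR: "a \<in> polyring V"
      unfolding a_def by (intro polyring.Rmult \<eta>(2)) (auto simp: polyring_def)
    have "a * (\<eta> * Var (w t)) = (\<eta> * \<eta>) * (Poly_Mapping.single m' (Poly_Mapping.lookup f m) * Var (w t))"
      unfolding a_def by (simp only: mult_ac)
    also have "\<dots> = Poly_Mapping.single m (Poly_Mapping.lookup f m)"
      by (simp add: \<eta> Var_def mult_single mm)
    finally have "Poly_Mapping.single m (Poly_Mapping.lookup f m) = a * (\<eta> * Var (w t))" by simp
    also have "\<dots> = (\<Sum>s\<in>M. (if s = t then a else 0) * (\<eta> * Var (w s)))"
      using fin t(1) by (simp add: if_distrib[of "\<lambda>c. c * _"] cong: if_cong)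
    also have "\<dots> \<in> lincomb (polyring V) (\<lambda>t. \<eta> * Var (w t)) M"
      by (rule polyring.lincombI) (use aR in auto)
    finally show ?thesis .
  qed
  then show "f \<in> lincomb (polyring V) (\<lambda>t. \<eta> * Var (w t)) M"
    by (subst monomial_sum[of f]) (rule polyring.lincomb_sum)
qed

text \<open>Multiplication by a monomial shifts each exponent \<open>k\<close> to
  \<open>k + m\<close> without cancellation. A variable of \<open>M\<close> that divides
  \<open>k + m\<close> does not divide \<open>m\<close>, so it divides \<open>k\<close>.\<close>

lemma monomial_colon:
  fixes f :: "('v, 'k::comm_ring_1) mpoly" and \<eta> :: "('v, 'k) mpoly"
  assumes M: "finite M" "w ` M \<subseteq> V" and \<eta>: "\<eta> * \<eta> = 1" "\<eta> \<in> polyring V"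
    and f: "f \<in> polyring V" and m: "Poly_Mapping.keys m \<inter> w ` M = {}"
    and fm: "f * Poly_Mapping.single m 1 \<in> lincomb (polyring V) (\<lambda>t. \<eta> * Var (w t)) M"
  shows "f \<in> lincomb (polyring V) (\<lambda>t. \<eta> * Var (w t)) M"
  unfolding lincomb_Var_iff[OF M \<eta>]
proof (intro conjI ballI f)
  fix k assume "k \<in> Poly_Mapping.keys f"
  then have "k + m \<in> Poly_Mapping.keys (f * Poly_Mapping.single m 1)"
    unfolding in_keys_iff lookup_mult_single_add by simp
  then obtain t where "t \<in> M" "w t \<in> Poly_Mapping.keys (k + m)"
    using fm unfolding lincomb_Var_iff[OF M \<eta>] by blast
  then show "\<exists>t\<in>M. w t \<in> Poly_Mapping.keys k" using m by (auto simp: keys_add_nat)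
qed

lemma prod_Var_monomial:
  assumes "finite A"
  shows "\<exists>m. (\<Prod>p\<in>A. Var (w p) :: ('v, 'k::comm_ring_1) mpoly) = Poly_Mapping.single m 1 \<and> Poly_Mapping.keys m = w ` A"
  using assms
proof (induction A rule: finite_induct)
  case empty
  then show ?case by (intro exI[of _ 0]) simp
next
  case (insert a A)
  then obtain m where "(\<Prod>p\<in>A. Var (w p) :: ('v, 'k) mpoly) = Poly_Mapping.single m 1" "Poly_Mapping.keys m = w ` A" by blast
  then show ?case using insert
    by (intro exI[of _ "Poly_Mapping.single (w a) 1 + m"]) (auto simp: Var_def mult_single keys_add_nat)
qed

section \<open>Vertex monomials, Koszul signs and the polynomial instance\<close>

definition vertex_monomial :: "'p set \<Rightarrow> 'p set \<Rightarrow> ('p \<times> bool, 'k::comm_ring_1) mpoly" where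
  "vertex_monomial P E = (\<Prod>p\<in>E. Var (p, True)) * (\<Prod>p\<in>P - E. Var (p, False))"

lemma vertex_monomial_single:
  assumes "finite P" "E \<subseteq> P"
  obtains m where "(vertex_monomial P E :: ('p \<times> bool, 'k::comm_ring_1) mpoly) = Poly_Mapping.single m 1"
    "Poly_Mapping.keys m = (\<lambda>p. (p, True)) ` E \<union> (\<lambda>p. (p, False)) ` (P - E)"
proof -
  have "finite E" using assms finite_subset by blast
  then obtain a b where "(\<Prod>p\<in>E. Var (p, True) :: ('p \<times> bool, 'k) mpoly) = Poly_Mapping.single a 1"
    "Poly_Mapping.keys a = (\<lambda>p. (p, True)) ` E"
    "(\<Prod>p\<in>P - E. Var (p, False) :: ('p \<times> bool, 'k) mpoly) = Poly_Mapping.single b 1"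
    "Poly_Mapping.keys b = (\<lambda>p. (p, False)) ` (P - E)"
    using prod_Var_monomial[of E "\<lambda>p. (p, True)"] prod_Var_monomial[of "P - E" "\<lambda>p. (p, False)"] assms(1)
    by auto
  then show thesis by (intro that[of "a + b"]) (simp_all add: vertex_monomial_def mult_single keys_add_nat)
qed

lemma homog_vertex_monomial:
  assumes "finite P" "E \<subseteq> P"
  shows "homog (card P) (vertex_monomial P E)"
proof -
  have "finite E" using assms finite_subset by blast
  then have "card P = card E + card (P - E)" using assms by (simp add: card_Diff_subset card_mono)
  then show ?thesis unfolding vertex_monomial_def
    using \<open>finite E\<close> assms(1) by (simp only:) (intro homog_mult homog_prod_Var; simp)
qed

text \<open>The sign of moving \<open>t\<close> into its place in an exterior product over
  \<open>T\<close>. Places come from a numbering, since the lattice order is only partial.\<close>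

definition order_sign :: "('p \<Rightarrow> nat) \<Rightarrow> 'p \<Rightarrow> 'p set \<Rightarrow> 'r::comm_ring_1" where
  "order_sign idx t T = (- 1) ^ card {s \<in> T. idx s < idx t}"

text \<open>With \<open>s\<close> before \<open>t\<close>, adding \<open>t\<close> keeps the sign of
  \<open>s\<close>, while adding \<open>s\<close> changes the sign of \<open>t\<close>.\<close>

lemma order_sign_swap_less:
  fixes idx :: "'p::finite \<Rightarrow> nat"
  assumes "idx s < idx t" "s \<notin> T" "t \<notin> T"
  shows "order_sign idx t T * order_sign idx s (insert t T)
      = - (order_sign idx s T * order_sign idx t (insert s T) :: 'r::comm_ring_1)"
proof -
  have "{r \<in> insert t T. idx r < idx s} = {r \<in> T. idx r < idx s}" using assms by auto
  moreover have "{r \<in> insert s T. idx r < idx t} = insert s {r \<in> T. idx r < idx t}" using assms by auto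
  ultimately show ?thesis using assms by (simp add: order_sign_def)
qed

lemma order_sign_swap:
  fixes idx :: "'p::finite \<Rightarrow> nat"
  assumes "inj idx" "s \<noteq> t" "s \<notin> T" "t \<notin> T"
  shows "order_sign idx t T * order_sign idx s (insert t T)
      = - (order_sign idx s T * order_sign idx t (insert s T) :: 'r::comm_ring_1)"
proof -
  have "idx s \<noteq> idx t" using assms by (auto dest: injD)
  then consider "idx s < idx t" | "idx t < idx s" by linarith
  then show ?thesis
  proof cases
    case 1
    then show ?thesis using order_sign_swap_less assms by blast
  next
    case 2
    then show ?thesis using order_sign_swap_less[of idx t s T, where 'r = 'r] assms by simp
  qed
qed

lemma order_sign_cases:
  "order_sign idx t T = (1 :: 'r::comm_ring_1) \<or> order_sign idx t T = (- 1 :: 'r)"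
  unfolding order_sign_def by (cases "even (card {s \<in> T. idx s < idx t})") auto

lemma polynomial_cube_complex:
  fixes idx :: "'p::finite \<Rightarrow> nat" and P :: "'p set"
  assumes inj: "inj idx"
  shows "cube_complex (polyring (P \<times> UNIV) :: ('p \<times> bool, 'k::comm_ring_1) mpoly set) P (order_sign idx)
    (\<lambda>t. Var (t, True)) (\<lambda>t. - Var (t, False)) (vertex_monomial P)"
proof -
  \<comment> \<open>the factors \<open>1\<close> and \<open>- 1\<close> play the role of \<open>\<eta>\<close> in \<open>monomial_colon\<close>\<close>
  have "cube_complex (polyring (P \<times> UNIV) :: ('p \<times> bool, 'k) mpoly set) P (order_sign idx)
    (\<lambda>t. 1 * Var (t, True)) (\<lambda>t. - 1 * Var (t, False)) (vertex_monomial P)"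
  proof unfold_locales
    let ?V = "P \<times> (UNIV :: bool set)"
    let ?R = "polyring ?V :: ('p \<times> bool, 'k) mpoly set"
    have m1: "- 1 \<in> ?R" "(- 1) * (- 1) = (1 :: ('p \<times> bool, 'k) mpoly)" "(1 :: ('p \<times> bool, 'k) mpoly) * 1 = 1"
      by auto
    have sub: "M \<subseteq> P \<Longrightarrow> (\<lambda>t. (t, b)) ` M \<subseteq> ?V" for M and b :: bool by auto
    \<comment> \<open>All four colon axioms are instances: \<open>m\<close> is a single variable in
      the first two and the exponent of the vertex monomial in the others.\<close>
    have col: "f \<in> lincomb ?R (\<lambda>t. \<eta> * Var (t, b)) M"
      if "M \<subseteq> P" "\<eta> = 1 \<or> \<eta> = - 1" "f \<in> ?R" "Poly_Mapping.keys m \<inter> (\<lambda>t. (t, b)) ` M = {}"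
        "f * Poly_Mapping.single m 1 \<in> lincomb ?R (\<lambda>t. \<eta> * Var (t, b)) M" for \<eta> b M f m
      by (rule monomial_colon[where w = "\<lambda>t. (t, b)", OF _ sub[OF that(1)] _ _ that(3-5)])
        (use that(2) m1 in auto)
    show "finite P" by simp
    show "order_sign idx t T \<in> ?R" for t T
      using order_sign_cases[of idx t T, where 'r = "('p \<times> bool, 'k) mpoly"] m1 by auto
    show "order_sign idx t T * order_sign idx t T = (1 :: ('p \<times> bool, 'k) mpoly)" for t T
      using order_sign_cases[of idx t T, where 'r = "('p \<times> bool, 'k) mpoly"] by auto
    show "order_sign idx t T * order_sign idx s (insert t T)
        = - (order_sign idx s T * order_sign idx t (insert s T) :: ('p \<times> bool, 'k) mpoly)"
      if "s \<noteq> t" "s \<notin> T" "t \<notin> T" for s t T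
      by (rule order_sign_swap[OF inj that])
    show "1 * Var (t, True) \<in> ?R" "- 1 * Var (t, False) \<in> ?R" if "t \<in> P" for t
      using that by (auto intro!: polyring.Ruminus Var_polyring)
    show "vertex_monomial P E \<in> ?R" if E: "E \<subseteq> P" for E
    proof -
      obtain m where "(vertex_monomial P E :: ('p \<times> bool, 'k) mpoly) = Poly_Mapping.single m 1"
        "Poly_Mapping.keys m = (\<lambda>p. (p, True)) ` E \<union> (\<lambda>p. (p, False)) ` (P - E)"
        using vertex_monomial_single[OF finite E] .
      then show ?thesis using E by (auto simp: polyring_def)
    qed
    show "1 * Var (t, True) * vertex_monomial P E + - 1 * Var (t, False) * vertex_monomial P (insert t E)
        = (0 :: ('p \<times> bool, 'k) mpoly)" if "E \<subseteq> P" "t \<in> P - E" for E t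
    proof -
      have "(\<Prod>p\<in>P - E. Var (p, False) :: ('p \<times> bool, 'k) mpoly)
          = Var (t, False) * (\<Prod>p\<in>P - insert t E. Var (p, False))"
        using that by (subst prod.remove[of _ t]) (auto simp: Diff_insert2 [symmetric] Diff_insert[symmetric])
      then show ?thesis using that by (simp add: vertex_monomial_def algebra_simps)
    qed
    show "f \<in> lincomb ?R (\<lambda>t. 1 * Var (t, True)) M"
      if "M \<subseteq> P" "t \<in> P - M" "f \<in> ?R" "1 * Var (t, True) * f \<in> lincomb ?R (\<lambda>t. 1 * Var (t, True)) M" for M t f
      by (rule col[of M 1 f "Poly_Mapping.single (t, True) 1"])
        (use that in \<open>auto simp: Var_single mult.commute\<close>)
    show "f \<in> lincomb ?R (\<lambda>t. - 1 * Var (t, False)) M"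
      if "M \<subseteq> P" "t \<in> P - M" "f \<in> ?R" "- 1 * Var (t, False) * f \<in> lincomb ?R (\<lambda>t. - 1 * Var (t, False)) M" for M t f
      by (rule col[of M "- 1" f "Poly_Mapping.single (t, False) 1"])
        (use that polyring.lincomb_uminus[OF that(4)] in \<open>auto simp: Var_single mult.commute\<close>)
    show "f \<in> lincomb ?R (\<lambda>t. 1 * Var (t, True)) M"
      if "M \<subseteq> P" and E: "E \<subseteq> P" and "M \<inter> E = {}" "f \<in> ?R"
        "f * vertex_monomial P E \<in> lincomb ?R (\<lambda>t. 1 * Var (t, True)) M" for M E f
    proof -
      obtain m where m: "(vertex_monomial P E :: ('p \<times> bool, 'k) mpoly) = Poly_Mapping.single m 1"
        "Poly_Mapping.keys m = (\<lambda>p. (p, True)) ` E \<union> (\<lambda>p. (p, False)) ` (P - E)"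
        using vertex_monomial_single[OF finite E] .
      show ?thesis by (rule col[OF that(1) _ that(4) _ that(5)[unfolded m(1)]]) (use m(2) that(3) in auto)
    qed
    show "f \<in> lincomb ?R (\<lambda>t. - 1 * Var (t, False)) M"
      if "M \<subseteq> P" and E: "E \<subseteq> P" and "M \<subseteq> E" "f \<in> ?R"
        "f * vertex_monomial P E \<in> lincomb ?R (\<lambda>t. - 1 * Var (t, False)) M" for M E f
    proof -
      obtain m where m: "(vertex_monomial P E :: ('p \<times> bool, 'k) mpoly) = Poly_Mapping.single m 1"
        "Poly_Mapping.keys m = (\<lambda>p. (p, True)) ` E \<union> (\<lambda>p. (p, False)) ` (P - E)"
        using vertex_monomial_single[OF finite E] .
      show ?thesis by (rule col[OF that(1) _ that(4) _ that(5)[unfolded m(1)]]) (use m(2) that(3) in auto)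
    qed
    have mem: "vertex_monomial P E \<in> lincomb ?R (\<lambda>t. \<eta> * Var (t, b)) M"
      if "M \<subseteq> P" and E: "E \<subseteq> P" and "\<eta> = 1 \<or> \<eta> = - 1" "t \<in> M" "t \<in> E \<longleftrightarrow> b" for \<eta> b M E t
    proof -
      obtain m where m: "(vertex_monomial P E :: ('p \<times> bool, 'k) mpoly) = Poly_Mapping.single m 1"
        "Poly_Mapping.keys m = (\<lambda>p. (p, True)) ` E \<union> (\<lambda>p. (p, False)) ` (P - E)"
        using vertex_monomial_single[OF finite E] .
      have "(t, b) \<in> Poly_Mapping.keys m" using m(2) that by (cases b) auto
      moreover have "Poly_Mapping.single m 1 \<in> ?R" using m(2) that(2) by (auto simp: polyring_def)
      ultimately show ?thesis unfolding m(1)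
        using lincomb_Var_iff[of M "\<lambda>t. (t, b)" ?V \<eta> "Poly_Mapping.single m 1"] sub[OF that(1)] that m1
        by auto
    qed
    show "vertex_monomial P E \<in> lincomb ?R (\<lambda>t. 1 * Var (t, True)) M"
      if "M \<subseteq> P" and E: "E \<subseteq> P" and "M \<inter> E \<noteq> {}" for M E
      using mem[OF that(1,2), of 1 _ True] that(3) by auto
    show "vertex_monomial P E \<in> lincomb ?R (\<lambda>t. - 1 * Var (t, False)) M"
      if "M \<subseteq> P" and E: "E \<subseteq> P" and "\<not> M \<subseteq> E" for M E
      using mem[OF that(1,2), of "- 1" _ False] that(3) by auto
  qed
  then show ?thesis by simp
qed

section \<open>From bases of cells to numbered matrices\<close>

text \<open>\<open>has_linear_resolution\<close> asks for vectors and matrices numbered by naturals.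
  Here any finite set \<open>Z i\<close> may serve as the basis in degree \<open>i\<close>, and the
  transport along bijections is done once.\<close>

lemma has_linear_resolutionI:
  fixes Z :: "nat \<Rightarrow> 'c set" and \<gamma> :: "'c \<Rightarrow> ('v, 'k::field) mpoly" and \<alpha> :: "'c \<Rightarrow> 'c \<Rightarrow> ('v, 'k) mpoly"
  assumes fin: "\<And>i. finite (Z i)"
    and \<gamma>: "\<And>c. c \<in> Z 0 \<Longrightarrow> \<gamma> c \<in> polyring V \<and> homog d (\<gamma> c)"
    and \<alpha>: "\<And>i c c'. c \<in> Z i \<Longrightarrow> c' \<in> Z (Suc i) \<Longrightarrow> \<alpha> c c' \<in> polyring V \<and> homog 1 (\<alpha> c c')"
    and M: "M = {(\<Sum>c\<in>Z 0. z c * \<gamma> c) | z. \<forall>c\<in>Z 0. z c \<in> polyring V}"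
    and ex0: "\<And>z. (\<forall>c\<in>Z 0. z c \<in> polyring V) \<Longrightarrow> (\<Sum>c\<in>Z 0. z c * \<gamma> c) = 0 \<longleftrightarrow>
       (\<exists>w. (\<forall>c\<in>Z 1. w c \<in> polyring V) \<and> (\<forall>c\<in>Z 0. z c = (\<Sum>c'\<in>Z 1. \<alpha> c c' * w c')))"
    and exS: "\<And>i z. (\<forall>c\<in>Z (Suc i). z c \<in> polyring V) \<Longrightarrow>
       (\<forall>c\<in>Z i. (\<Sum>c'\<in>Z (Suc i). \<alpha> c c' * z c') = 0) \<longleftrightarrow>
       (\<exists>w. (\<forall>c\<in>Z (Suc (Suc i)). w c \<in> polyring V) \<and>
          (\<forall>c\<in>Z (Suc i). z c = (\<Sum>c'\<in>Z (Suc (Suc i)). \<alpha> c c' * w c')))"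
  shows "has_linear_resolution V M"
proof -
  define b where "b i = card (Z i)" for i
  have "\<forall>i. \<exists>e. bij_betw e {..<b i} (Z i)"
    using fin ex_bij_betw_nat_finite unfolding b_def atLeast0LessThan[symmetric] by blast
  from choice[OF this] obtain e where e: "\<And>i. bij_betw (e i) {..<b i} (Z i)" by blast
  define g where "g j = \<gamma> (e 0 j)" for j
  define A where "A i r c = \<alpha> (e i r) (e (Suc i) c)" for i r c
  \<comment> \<open>Vectors in \<open>freemod\<close> must vanish from \<open>b i\<close> on, hence
    the padding by 0.\<close>
  define vec where "vec i z j = (if j < b i then z (e i j) else 0)" for i j and z :: "'c \<Rightarrow> ('v, 'k) mpoly"
  define coord where "coord i v c = v (inv_into {..<b i} (e i) c)" for i c and v :: "nat \<Rightarrow> ('v, 'k) mpoly"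
  have eZ: "e i j \<in> Z i" if "j < b i" for i j using e that by (auto dest: bij_betwE)
  have eZ': "\<exists>j<b i. c = e i j" if "c \<in> Z i" for i c
    using bij_betw_imp_surj_on[OF e[of i]] that by auto
  have coord_e: "coord i v (e i j) = v j" if "j < b i" for i v j
    unfolding coord_def using inv_into_f_f[OF bij_betw_imp_inj_on[OF e]] that by simp
  have vec_e: "vec i z j = z (e i j)" if "j < b i" for i z j using that by (simp add: vec_def)
  have vec_free: "vec i z \<in> freemod V (b i)" if "\<forall>c\<in>Z i. z c \<in> polyring V" for i z
    using that eZ by (auto simp: freemod_def vec_def)
  have coord_R: "\<forall>c\<in>Z i. coord i v c \<in> polyring V" if "v \<in> freemod V (b i)" for i v
  proof
    fix c assume "c \<in> Z i"
    then obtain j where "j < b i" "c = e i j" using eZ' by blast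
    then show "coord i v c \<in> polyring V" using coord_e that by (auto simp: freemod_def)
  qed
  have sumZ: "(\<Sum>j<b i. h (e i j)) = sum h (Z i)" for i and h :: "'c \<Rightarrow> ('v, 'k) mpoly"
    by (rule sum.reindex_bij_betw[OF e])
  have sum_g: "(\<Sum>j<b 0. v j * g j) = (\<Sum>c\<in>Z 0. coord 0 v c * \<gamma> c)" for v
    unfolding sumZ[symmetric] g_def by (intro sum.cong) (auto simp: coord_e)
  have sum_A: "(\<Sum>j<b (Suc i). A i r j * v j) = (\<Sum>c'\<in>Z (Suc i). \<alpha> (e i r) c' * coord (Suc i) v c')" for i r v
    unfolding sumZ[symmetric] A_def by (intro sum.cong) (auto simp: coord_e)
  have cong_g: "(\<Sum>c\<in>Z 0. coord 0 (vec 0 z) c * \<gamma> c) = (\<Sum>c\<in>Z 0. z c * \<gamma> c)" for z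
    unfolding sumZ[symmetric] by (intro sum.cong) (auto simp: coord_e vec_e)
  have cong_A: "(\<Sum>c'\<in>Z i. \<alpha> c c' * coord i (vec i z) c') = (\<Sum>c'\<in>Z i. \<alpha> c c' * z c')" for z i c
    unfolding sumZ[symmetric] by (intro sum.cong) (auto simp: coord_e vec_e)
  have image: "v \<in> matapp (b i) (b (Suc i)) (A i) ` freemod V (b (Suc i)) \<longleftrightarrow>
      (\<exists>w. (\<forall>c\<in>Z (Suc i). w c \<in> polyring V) \<and> (\<forall>c\<in>Z i. coord i v c = (\<Sum>c'\<in>Z (Suc i). \<alpha> c c' * w c')))"
    if v: "v \<in> freemod V (b i)" for i v
  proof
    assume "v \<in> matapp (b i) (b (Suc i)) (A i) ` freemod V (b (Suc i))"
    then obtain w where w: "w \<in> freemod V (b (Suc i))" "v = matapp (b i) (b (Suc i)) (A i) w" by blast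
    have "coord i v c = (\<Sum>c'\<in>Z (Suc i). \<alpha> c c' * coord (Suc i) w c')" if c: "c \<in> Z i" for c
    proof -
      obtain j where "j < b i" "c = e i j" using eZ'[OF c] by blast
      then show ?thesis by (simp add: coord_e w(2) matapp_def sum_A)
    qed
    then show "\<exists>w. (\<forall>c\<in>Z (Suc i). w c \<in> polyring V) \<and> (\<forall>c\<in>Z i. coord i v c = (\<Sum>c'\<in>Z (Suc i). \<alpha> c c' * w c'))"
      using coord_R[OF w(1)] by blast
  next
    assume "\<exists>w. (\<forall>c\<in>Z (Suc i). w c \<in> polyring V) \<and> (\<forall>c\<in>Z i. coord i v c = (\<Sum>c'\<in>Z (Suc i). \<alpha> c c' * w c'))"
    then obtain w where w: "\<forall>c\<in>Z (Suc i). w c \<in> polyring V"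
      "\<forall>c\<in>Z i. coord i v c = (\<Sum>c'\<in>Z (Suc i). \<alpha> c c' * w c')" by blast
    have "v = matapp (b i) (b (Suc i)) (A i) (vec (Suc i) w)"
    proof
      fix j
      show "v j = matapp (b i) (b (Suc i)) (A i) (vec (Suc i) w) j"
      proof (cases "j < b i")
        case True
        then have "v j = coord i v (e i j)" by (simp add: coord_e)
        also have "\<dots> = (\<Sum>c'\<in>Z (Suc i). \<alpha> (e i j) c' * w c')" using w(2) eZ[OF True] by blast
        finally show ?thesis using True by (simp add: matapp_def sum_A cong_A)
      next
        case False
        then show ?thesis using v by (auto simp: matapp_def freemod_def)
      qed
    qed
    then show "v \<in> matapp (b i) (b (Suc i)) (A i) ` freemod V (b (Suc i))"
      using vec_free[OF w(1)] by blast
  qed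
  have kernel: "matapp (b i) (b (Suc i)) (A i) v = (\<lambda>_. 0) \<longleftrightarrow>
      (\<forall>c\<in>Z i. (\<Sum>c'\<in>Z (Suc i). \<alpha> c c' * coord (Suc i) v c') = 0)" for i v
  proof
    assume *: "matapp (b i) (b (Suc i)) (A i) v = (\<lambda>_. 0)"
    show "\<forall>c\<in>Z i. (\<Sum>c'\<in>Z (Suc i). \<alpha> c c' * coord (Suc i) v c') = 0"
    proof
      fix c assume "c \<in> Z i"
      then obtain j where "j < b i" "c = e i j" using eZ' by blast
      then show "(\<Sum>c'\<in>Z (Suc i). \<alpha> c c' * coord (Suc i) v c') = 0"
        using fun_cong[OF *, of j] by (simp add: matapp_def sum_A)
    qed
  next
    assume "\<forall>c\<in>Z i. (\<Sum>c'\<in>Z (Suc i). \<alpha> c c' * coord (Suc i) v c') = 0"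
    then show "matapp (b i) (b (Suc i)) (A i) v = (\<lambda>_. 0)"
      using eZ by (auto simp: matapp_def sum_A)
  qed
  have mat_free: "matapp (b i) (b (Suc i)) (A i) w \<in> freemod V (b i)" if "w \<in> freemod V (b (Suc i))" for i w
  proof -
    have "A i r c \<in> polyring V" if "r < b i" "c < b (Suc i)" for r c
      using \<alpha>[OF eZ[OF that(1)] eZ[OF that(2)]] by (simp add: A_def)
    then show ?thesis
      using that unfolding freemod_def matapp_def by (auto intro!: polyring.Rsum polyring.Rmult)
  qed
  show ?thesis
    unfolding has_linear_resolution_def
  proof (intro exI conjI allI impI)
    show "g j \<in> polyring V" "homog d (g j)" if "j < b 0" for j
      using \<gamma> eZ that by (auto simp: g_def)
    show "A i r c \<in> polyring V" "homog 1 (A i r c)" if "r < b i \<and> c < b (Suc i)" for i r c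
      using \<alpha>[OF eZ eZ, of r i c] that by (auto simp: A_def)
    show "M = {(\<Sum>j<b 0. v j * g j) | v. v \<in> freemod V (b 0)}"
      unfolding M sum_g
    proof safe
      fix z :: "'c \<Rightarrow> ('v, 'k) mpoly" assume z: "\<forall>c\<in>Z 0. z c \<in> polyring V"
      show "\<exists>v. (\<Sum>c\<in>Z 0. z c * \<gamma> c) = (\<Sum>c\<in>Z 0. coord 0 v c * \<gamma> c) \<and> v \<in> freemod V (b 0)"
        using vec_free[OF z] cong_g[of z] by metis
    next
      fix v :: "nat \<Rightarrow> ('v, 'k) mpoly" assume "v \<in> freemod V (b 0)"
      then show "\<exists>z. (\<Sum>c\<in>Z 0. coord 0 v c * \<gamma> c) = (\<Sum>c\<in>Z 0. z c * \<gamma> c) \<and> (\<forall>c\<in>Z 0. z c \<in> polyring V)"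
        using coord_R by blast
    qed
    have "v \<in> matapp (b 0) (b 1) (A 0) ` freemod V (b 1) \<longleftrightarrow> (\<Sum>j<b 0. v j * g j) = 0"
      if v: "v \<in> freemod V (b 0)" for v
      using image[OF v] ex0[OF coord_R[OF v]] unfolding sum_g by simp
    then show "{v \<in> freemod V (b 0). (\<Sum>j<b 0. v j * g j) = 0} = matapp (b 0) (b 1) (A 0) ` freemod V (b 1)"
      using mat_free[of _ 0] by auto
    fix i
    have "v \<in> matapp (b (Suc i)) (b (Suc (Suc i))) (A (Suc i)) ` freemod V (b (Suc (Suc i))) \<longleftrightarrow>
        matapp (b i) (b (Suc i)) (A i) v = (\<lambda>_. 0)"
      if v: "v \<in> freemod V (b (Suc i))" for v
      using image[OF v] exS[OF coord_R[OF v]] unfolding kernel by simp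
    then show "{v \<in> freemod V (b (Suc i)). matapp (b i) (b (Suc i)) (A i) v = (\<lambda>_. 0)}
          = matapp (b (Suc i)) (b (Suc (Suc i))) (A (Suc i)) ` freemod V (b (Suc (Suc i)))"
      using mat_free[of _ "Suc i"] by auto
  qed
qed

section \<open>Down-sets of join-irreducible elements\<close>

lemma below_cover:
  fixes a p :: "'a::{finite, order}"
  assumes "a < p"
  obtains q where "covers q p" "a \<le> q"
proof -
  have "finite {r. a \<le> r \<and> r < p}" "a \<in> {r. a \<le> r \<and> r < p}" using assms by auto
  then obtain q where q: "q \<in> {r. a \<le> r \<and> r < p}" "\<And>r. r \<in> {r. a \<le> r \<and> r < p} \<Longrightarrow> q \<le> r \<Longrightarrow> q = r"
    using finite_has_maximal2 by (metis (no_types, lifting))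
  have "covers q p" unfolding covers_def
  proof (intro conjI notI)
    show "q < p" using q by auto
    assume "\<exists>r. q < r \<and> r < p"
    then obtain r where r: "q < r" "r < p" by blast
    then have "q = r" using q(1) by (intro q(2)) auto
    then show False using r by simp
  qed
  then show thesis using q that by auto
qed

lemma lowset_mono: "x \<le> y \<Longrightarrow> lowset x \<subseteq> lowset y"
  by (auto simp: lowset_def)

text \<open>Otherwise \<open>inf p a\<close> and \<open>inf p b\<close> are strictly below
  \<open>p\<close>, hence below its only lower neighbour \<open>q\<close>. By distributivity
  \<open>p = inf p (sup a b)\<close> is then below \<open>q\<close>.\<close>

lemma JI_le_sup:
  fixes p a b :: "'a::{finite, distrib_lattice}"
  assumes "p \<in> JI" "p \<le> sup a b"
  shows "p \<le> a \<or> p \<le> b"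
proof (rule ccontr)
  assume "\<not> (p \<le> a \<or> p \<le> b)"
  then have lt: "inf p a < p" "inf p b < p"
    by (metis inf.cobounded1 inf.cobounded2 order.not_eq_order_implies_strict)+
  obtain q where q: "covers q p" "\<And>r. covers r p \<Longrightarrow> r = q"
    using assms(1) unfolding JI_def join_irred_def by blast
  have "inf p a \<le> q" "inf p b \<le> q"
    using below_cover[OF lt(1)] below_cover[OF lt(2)] q(2) by metis+
  then have "inf p (sup a b) \<le> q" by (simp add: inf_sup_distrib1)
  then have "p \<le> q" using assms(2) by (simp add: inf.absorb1)
  then show False using q(1) by (auto simp: covers_def)
qed

text \<open>Every element is determined by the join-irreducibles below it: one that is neither
  minimal nor join-irreducible is the join of two lower neighbours, to which induction
  applies.\<close>

lemma lowset_le: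
  fixes x y :: "'a::{finite, distrib_lattice}"
  assumes "lowset x \<subseteq> lowset y"
  shows "x \<le> y"
  using assms
proof (induction "card {z. z \<le> x}" arbitrary: x rule: less_induct)
  case less
  have IH: "c \<le> y" if "c < x" for c
  proof (rule less.hyps)
    have "x \<in> {z. z \<le> x} - {z. z \<le> c}" "{z. z \<le> c} \<subseteq> {z. z \<le> x}" using that by auto
    then show "card {z. z \<le> c} < card {z. z \<le> x}"
      by (intro psubset_card_mono finite psubsetI) blast+
    show "lowset c \<subseteq> lowset y"
      using order_trans[OF lowset_mono[OF less_imp_le[OF that]] less.prems] .
  qed
  show ?case
  proof (rule ccontr)
    assume nle: "\<not> x \<le> y"
    then have "x \<notin> JI" using less.prems by (auto simp: lowset_def)
    \<comment> \<open>The least element also fails to be join-irreducible, for want of a lower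
      neighbour. This inequality excludes it, so \<open>x\<close> has at least two.\<close>
    have "inf x y < x" using nle by (metis inf.cobounded1 inf.cobounded2 order.not_eq_order_implies_strict)
    then obtain c where c: "covers c x" using below_cover by blast
    then obtain d where d: "covers d x" "d \<noteq> c"
      using \<open>x \<notin> JI\<close> unfolding JI_def join_irred_def by blast
    have lt: "c < x" "d < x" using c d by (auto simp: covers_def)
    have "\<not> d \<le> c" using d c lt by (auto simp: covers_def order.strict_iff_order)
    then have "c < sup c d" by (simp add: less_le_not_le)
    moreover have "sup c d \<le> x" using lt by (simp add: less_imp_le)
    ultimately have "sup c d = x" using c unfolding covers_def
      by (metis order.not_eq_order_implies_strict)
    then show False using IH[OF lt(1)] IH[OF lt(2)] nle by auto
  qed
qed

lemma lowset_subset_iff: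
  fixes x y :: "'a::{finite, distrib_lattice}"
  shows "lowset x \<subseteq> lowset y \<longleftrightarrow> x \<le> y"
  using lowset_le lowset_mono by blast

lemma inj_lowset: "inj (lowset :: 'a::{finite, distrib_lattice} \<Rightarrow> 'a set)"
  by (rule injI) (metis lowset_subset_iff order.antisym order.refl)

lemma JI_le_Sup_fin:
  fixes p :: "'a::{finite, distrib_lattice}"
  assumes "p \<in> JI" "finite D" "D \<noteq> {}" "p \<le> Sup_fin D"
  shows "\<exists>d\<in>D. p \<le> d"
  using assms(2-4)
proof (induction D rule: finite_ne_induct)
  case (insert d D)
  then show ?case using JI_le_sup[OF assms(1), of d "Sup_fin D"] by (auto simp: Sup_fin.insert)
qed auto

text \<open>Birkhoff's representation: a nonempty down-set \<open>D\<close> of \<open>JI\<close> is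
  recovered from its join, because join-irreducibles are join-prime.\<close>

lemma range_lowset:
  "range lowset = {D. D \<subseteq> (JI :: 'a::{finite, distrib_lattice} set) \<and> (\<forall>p\<in>D. \<forall>q\<in>JI. q \<le> p \<longrightarrow> q \<in> D)}"
proof (intro equalityI subsetI)
  fix D :: "'a set" assume "D \<in> {D. D \<subseteq> JI \<and> (\<forall>p\<in>D. \<forall>q\<in>JI. q \<le> p \<longrightarrow> q \<in> D)}"
  then have D: "D \<subseteq> JI" "\<And>p q. p \<in> D \<Longrightarrow> q \<in> JI \<Longrightarrow> q \<le> p \<Longrightarrow> q \<in> D" by auto
  show "D \<in> range lowset"
  proof (cases "D = {}")
    case True
    \<comment> \<open>The empty down-set belongs to the least element, written
      \<open>Inf_fin UNIV\<close>, which has no lower neighbour.\<close>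
    have "p \<notin> JI" if "p \<le> Inf_fin UNIV" for p :: 'a
    proof
      assume "p \<in> JI"
      then obtain q where "q < p" unfolding JI_def join_irred_def covers_def by blast
      then have "q < Inf_fin UNIV" using that by simp
      then show False using Inf_fin.coboundedI[of UNIV q] by auto
    qed
    then have "lowset (Inf_fin UNIV :: 'a) = {}" by (auto simp: lowset_def)
    then show ?thesis using True by (metis rangeI)
  next
    case False
    have "lowset (Sup_fin D) = D"
    proof (intro equalityI subsetI)
      fix p assume "p \<in> lowset (Sup_fin D)"
      then have p: "p \<in> JI" "p \<le> Sup_fin D" by (auto simp: lowset_def)
      obtain d where "d \<in> D" "p \<le> d" using JI_le_Sup_fin[OF p(1) finite False p(2)] by blast
      then show "p \<in> D" using D(2) p(1) by blast
    next
      fix p assume "p \<in> D"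
      then show "p \<in> lowset (Sup_fin D)"
        using D(1) Sup_fin.coboundedI[of D p] by (auto simp: lowset_def)
    qed
    then show ?thesis by (metis rangeI)
  qed
qed (auto simp: lowset_def)

text \<open>A maximal \<open>t\<close> of \<open>D - E\<close> is maximal in \<open>D\<close>: an
  element of \<open>E\<close> above \<open>t\<close> would force \<open>t\<close> into
  \<open>E\<close>.\<close>

lemma range_lowset_remove_maximal:
  fixes D E :: "'a::{finite, distrib_lattice} set"
  assumes "D \<in> range lowset" "E \<in> range lowset" "\<not> D \<subseteq> E"
  shows "\<exists>t\<in>D - E. D - {t} \<in> range lowset"
proof -
  have "finite (D - E)" "D - E \<noteq> {}" using assms(3) by auto
  then obtain t where t: "t \<in> D - E" "\<And>s. s \<in> D - E \<Longrightarrow> t \<le> s \<Longrightarrow> t = s"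
    using finite_has_maximal by metis
  have "D - {t} \<in> range lowset"
    unfolding range_lowset
  proof (intro CollectI conjI ballI impI)
    have D: "D \<subseteq> JI" "\<forall>p\<in>D. \<forall>q\<in>JI. q \<le> p \<longrightarrow> q \<in> D" and E: "\<forall>p\<in>E. \<forall>q\<in>JI. q \<le> p \<longrightarrow> q \<in> E"
      using assms(1,2) unfolding range_lowset by simp_all
    show "D - {t} \<subseteq> JI" using D(1) by auto
    fix p q assume pq: "p \<in> D - {t}" "q \<in> JI" "q \<le> p"
    have "q \<noteq> t"
    proof
      assume "q = t"
      then have "p \<notin> E" using E pq t(1) by blast
      then show False using t(2)[of p] pq \<open>q = t\<close> by auto
    qed
    then show "q \<in> D - {t}" using D(2) pq by blast
  qed
  then show ?thesis using t(1) by blast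
qed

text \<open>For a minimal \<open>t\<close> of \<open>D - E\<close>, the join-irreducibles strictly
  below \<open>t\<close> lie in \<open>D\<close>, hence in \<open>E\<close>.\<close>

lemma range_lowset_insert_minimal:
  fixes D E :: "'a::{finite, distrib_lattice} set"
  assumes "D \<in> range lowset" "E \<in> range lowset" "\<not> D \<subseteq> E"
  shows "\<exists>t\<in>D - E. insert t E \<in> range lowset"
proof -
  have "finite (D - E)" "D - E \<noteq> {}" using assms(3) by auto
  then obtain t where t: "t \<in> D - E" "\<And>s. s \<in> D - E \<Longrightarrow> s \<le> t \<Longrightarrow> t = s"
    using finite_has_minimal by metis
  have "insert t E \<in> range lowset"
    unfolding range_lowset
  proof (intro CollectI conjI ballI impI)
    have D: "D \<subseteq> JI" "\<forall>p\<in>D. \<forall>q\<in>JI. q \<le> p \<longrightarrow> q \<in> D"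
      and E: "E \<subseteq> JI" "\<forall>p\<in>E. \<forall>q\<in>JI. q \<le> p \<longrightarrow> q \<in> E"
      using assms(1,2) unfolding range_lowset by simp_all
    show "insert t E \<subseteq> JI" using D(1) E(1) t(1) by auto
    fix p q assume pq: "p \<in> insert t E" "q \<in> JI" "q \<le> p"
    show "q \<in> insert t E"
    proof (cases "p = t")
      case True
      then have "q \<in> D" using D(2) pq t(1) by blast
      then show ?thesis using t(2)[of q] pq True by auto
    next
      case False
      then show ?thesis using E(2) pq by blast
    qed
  qed
  then show ?thesis using t(1) by blast
qed

section \<open>Assembly of the resolution\<close>

lemma u_mon_eq: "u_mon q = vertex_monomial JI (lowset q)"
  by (simp add: u_mon_def vertex_monomial_def)

theorem theorem3p10:
  fixes I J :: "'a::{finite, distrib_lattice} set"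
  assumes "poset_ideal I"
    and "poset_coideal J"
    and "I \<union> J = UNIV"
    and "I \<inter> J = {}"
  shows "has_linear_resolution (Svars :: ('a \<times> bool) set)
           (H_ideal I \<inter> H_ideal J :: ('a \<times> bool, 'k::field) mpoly set)"
proof -
  obtain idx :: "'a \<Rightarrow> nat" where idx: "inj idx"
    using finite_imp_inj_to_nat_seg[OF finite[of "UNIV :: 'a set"]] by blast
  define P where "P = (JI :: 'a set)"
  let ?R = "polyring Svars :: ('a \<times> bool, 'k) mpoly set"
  interpret cube_complex ?R P "order_sign idx" "\<lambda>t. Var (t, True)" "\<lambda>t. - Var (t, False)"
    "vertex_monomial P :: 'a set \<Rightarrow> ('a \<times> bool, 'k) mpoly"
    unfolding Svars_def P_def by (rule polynomial_cube_complex[OF idx])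
  define L where "L = (range lowset :: 'a set set)"
  define FI where "FI = lowset ` I"
  define FJ where "FJ = lowset ` J"
  define XI where "XI = down_cubes L FI"
  define XJ where "XJ = up_cubes L FJ"
  \<comment> \<open>The cells that cross from the ideal to the coideal: bottom in \<open>FI\<close>
    and top in \<open>FJ\<close>.\<close>
  define XR where "XR = cubes L - XI - XJ"
  have LP: "L \<subseteq> Pow P" unfolding L_def P_def range_lowset by auto
  have Lun: "D \<union> E \<in> L" and Lint: "D \<inter> E \<in> L" if "D \<in> L" "E \<in> L" for D E
    using that unfolding L_def range_lowset by auto
  have FL: "FI \<union> FJ = L" "FI \<inter> FJ = {}"
    using assms(3,4) image_Un[of lowset I J] image_Int[OF inj_lowset, of I J]
    by (auto simp: L_def FI_def FJ_def)
  have FIdown: "E \<in> FI" if "D \<in> FI" "E \<in> L" "E \<subseteq> D" for D E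
    using that assms(1) unfolding FI_def L_def poset_ideal_def by (auto simp: lowset_subset_iff)
  have FJup: "D \<in> FJ" if "E \<in> FJ" "D \<in> L" "E \<subseteq> D" for D E
    using that assms(2) unfolding FJ_def L_def poset_coideal_def by (auto simp: lowset_subset_iff)
  have FIL: "FI \<subseteq> L" and FJL: "FJ \<subseteq> L" using FL(1) by auto
  have remove: "\<exists>t\<in>D - E. D - {t} \<in> L" and insert: "\<exists>t\<in>D - E. insert t E \<in> L"
    if "D \<in> L" "E \<in> L" "\<not> D \<subseteq> E" for D E
    using that range_lowset_remove_maximal range_lowset_insert_minimal unfolding L_def by simp_all
  have XLup: "cubes L = up_cubes L L"
    using cubes_in(1) by (auto simp: up_cubes_def)
  interpret relative_complex ?R P "order_sign idx" "\<lambda>t. Var (t, True)" "\<lambda>t. - Var (t, False)"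
    "vertex_monomial P :: 'a set \<Rightarrow> ('a \<times> bool, 'k) mpoly" XI XJ "cubes L" XR
  proof unfold_locales
    show "face_closed XI" unfolding XI_def by (rule face_closed_down) (rule FIdown)
    show "face_closed XJ" unfolding XJ_def by (rule face_closed_up) (rule FJup)
    show "face_closed (cubes L)" by (rule face_closed_cubes)
    show "exact XI" unfolding XI_def
      by (rule exact_down[OF LP Lint remove FIL FIdown])
    show "exact XJ" unfolding XJ_def
      by (rule exact_up[OF LP Lun insert FJL FJup])
    show "exact (cubes L)" unfolding XLup
      by (rule exact_up[OF LP Lun insert order_refl])
    show "cubes L = XI \<union> XJ \<union> XR"
      by (auto simp: XR_def XI_def XJ_def up_cubes_def down_cubes_def)
    show "XI \<inter> XJ = {}"
    proof (intro equals0I)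
      fix c assume c: "c \<in> XI \<inter> XJ"
      then have "(fst c, snd c) \<in> cubes L" "fst c \<union> snd c \<in> FI" "fst c \<in> FJ"
        by (auto simp: XI_def XJ_def up_cubes_def down_cubes_def)
      then have "fst c \<in> FI \<inter> FJ" using FIdown[of "fst c \<union> snd c" "fst c"] cubes_in(1) by blast
      then show False using FL by blast
    qed
    show "XI \<inter> XR = {}" "XJ \<inter> XR = {}" by (auto simp: XR_def)
    show "(E, {}) \<notin> XR" for E
      using cubes_in(1)[of E "{}" L] FL(1)
      by (auto simp: XR_def XI_def XJ_def up_cubes_def down_cubes_def)
    show "XR \<subseteq> Pow P \<times> Pow P" by (auto simp: XR_def cubes_def)
  qed
  have inv: "inv lowset (lowset q) = q" for q :: 'a
    by (rule inv_f_f[OF inj_lowset])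
  \<comment> \<open>\<open>aug\<close> sees only the vertices of \<open>X\<close>, and
    \<open>lowset\<close> is injective, so coefficients on \<open>A\<close> and vertex chains on
    \<open>X\<close> correspond.\<close>
  have H: "(H_ideal A :: ('a \<times> bool, 'k) mpoly set) = aug ` chains X"
    if X: "\<And>E. (E, {}) \<in> X \<longleftrightarrow> E \<in> lowset ` A" for A and X :: "('a set \<times> 'a set) set"
  proof -
    have aug: "aug z = (\<Sum>q\<in>A. z (lowset q, {}) * u_mon q)" if z: "z \<in> chains X" for z
    proof -
      have "aug z = (\<Sum>E\<in>lowset ` A. z (E, {}) * vertex_monomial P E)"
        unfolding aug_def
      proof (rule sum.mono_neutral_right)
        show "lowset ` A \<subseteq> Pow P" by (auto simp: lowset_def P_def)
        show "\<forall>E\<in>Pow P - lowset ` A. z (E, {}) * vertex_monomial P E = 0"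
          using chainsD(2)[OF z] X by auto
      qed simp
      also have "\<dots> = (\<Sum>q\<in>A. z (lowset q, {}) * u_mon q)"
        by (subst sum.reindex) (auto simp: u_mon_eq P_def intro: inj_on_subset[OF inj_lowset])
      finally show ?thesis .
    qed
    show ?thesis
    proof (intro equalityI subsetI)
      fix f :: "('a \<times> bool, 'k) mpoly" assume "f \<in> H_ideal A"
      then obtain c where c: "\<forall>q\<in>A. c q \<in> ?R" "f = (\<Sum>q\<in>A. c q * u_mon q)"
        unfolding H_ideal_def by blast
      define z where "z = (\<lambda>(E, T :: 'a set). if E \<in> lowset ` A \<and> T = {} then c (inv lowset E) else 0)"
      have z: "z \<in> chains X"
        by (rule chainsI) (use X c(1) in \<open>auto simp: z_def inv split: prod.splits\<close>)
      have "aug z = f"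
        unfolding aug[OF z] c(2) by (intro sum.cong) (auto simp: z_def inv)
      then show "f \<in> aug ` chains X" using z by blast
    next
      fix f assume "f \<in> aug ` chains X"
      then obtain z where z: "z \<in> chains X" "f = aug z" by blast
      then show "f \<in> H_ideal A"
        unfolding H_ideal_def z(2) aug[OF z(1)]
        by (intro CollectI exI[of _ "\<lambda>q. z (lowset q, {})"] conjI ballI refl chainsD(1)[OF z(1)])
    qed
  qed
  have vertex: "(E, {}) \<in> cubes L \<longleftrightarrow> E \<in> L" for E
    using LP by (auto simp: cubes_def)
  have "(E, {}) \<in> XI \<longleftrightarrow> E \<in> lowset ` I" for E
    using FIL vertex[of E] unfolding FI_def[symmetric] XI_def down_cubes_def by auto
  from H[OF this] have HI: "(H_ideal I :: ('a \<times> bool, 'k) mpoly set) = aug ` chains XI" .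
  have "(E, {}) \<in> XJ \<longleftrightarrow> E \<in> lowset ` J" for E
    using FJL vertex[of E] unfolding FJ_def[symmetric] XJ_def up_cubes_def by auto
  from H[OF this] have HJ: "(H_ideal J :: ('a \<times> bool, 'k) mpoly set) = aug ` chains XJ" .
  have unitR: "unit_cell c c' \<in> ?R" for c c' by (simp add: unit_cell_def)
  have unitH: "homog 0 (unit_cell c c')" for c c' by (simp add: unit_cell_def homog_1)
  have signH: "homog 0 (order_sign idx t T :: ('a \<times> bool, 'k) mpoly)" for t T
    using order_sign_cases[of idx t T, where 'r = "('a \<times> bool, 'k) mpoly"] homog_1 homog_uminus by metis
  \<comment> \<open>Signs and unit cells are constants, so the degree comes from the single variable
    in each summand.\<close>
  have deltaH: "homog 1 (delta (unit_cell c) c')" for c c'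
  proof (cases c')
    case (Pair E T)
    have "homog 1 (if t \<in> E then - Var (t, False) else Var (t, True) :: ('a \<times> bool, 'k) mpoly)" for t
      using homog_Var homog_uminus[OF homog_Var] by auto
    then have "homog (0 + 1 + 0) (order_sign idx t T *
       (if t \<in> E then - Var (t, False) else Var (t, True)) * unit_cell c c'')" for t c''
      by (intro homog_mult signH unitH)
    then show ?thesis unfolding Pair delta_def prod.case by (intro homog_sum) simp
  qed
  have "homog 1 (res XI (delta (unit_cell c)) c')" for c c'
    unfolding res_def by (cases "c' \<in> XI") (simp_all only: if_True if_False homog_0 deltaH)
  \<comment> \<open>One variable from the differential times a vertex monomial of degree
    \<open>card P\<close>: this is the degree of the generators.\<close>
  then have augH: "homog (1 + card P) (aug (res XI (delta (unit_cell c))))" for c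
    unfolding aug_def by (intro homog_sum homog_mult homog_vertex_monomial finP) auto
  have "res XI (delta (unit_cell c)) \<in> chains XI" for c
    by (intro res_chains delta_in_R unitR)
  then have augR: "aug (res XI (delta (unit_cell c))) \<in> ?R" for c
    by (rule aug_in_R)
  have resR: "res (layer i) z \<in> chains (layer i)" if "\<forall>c\<in>layer i. z c \<in> ?R" for i z
    by (rule chainsI) (use that in \<open>auto simp: res_def\<close>)
  have d: "delta (res (layer i) z) c = (\<Sum>c'\<in>layer i. delta (unit_cell c') c * z c')"
    if "\<forall>c\<in>layer i. z c \<in> ?R" for i z c
    unfolding delta_chain[OF finite_layer resR[OF that]] by (intro sum.cong) (auto simp: res_def)
  have a: "aug (res XI (delta (res (layer i) z))) = (\<Sum>c\<in>layer i. z c * aug (res XI (delta (unit_cell c))))"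
    if "\<forall>c\<in>layer i. z c \<in> ?R" for i z
    unfolding aug_delta_chain[OF finite_layer resR[OF that]] by (intro sum.cong) (auto simp: res_def)
  \<comment> \<open>\<open>res\<close> sets values off the layer to 0, so coefficient families on a
    layer can be exchanged for chains.\<close>
  have ex: "(\<exists>w\<in>chains (layer (Suc i)). \<forall>c\<in>layer i. delta w c = res (layer i) z c) \<longleftrightarrow>
     (\<exists>w. (\<forall>c\<in>layer (Suc i). w c \<in> ?R) \<and> (\<forall>c\<in>layer i. z c = (\<Sum>c'\<in>layer (Suc i). delta (unit_cell c') c * w c')))"
    for i z
  proof
    assume "\<exists>w\<in>chains (layer (Suc i)). \<forall>c\<in>layer i. delta w c = res (layer i) z c"
    then obtain w where w: "w \<in> chains (layer (Suc i))" "\<forall>c\<in>layer i. delta w c = res (layer i) z c" by blast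
    have "z c = (\<Sum>c'\<in>layer (Suc i). delta (unit_cell c') c * w c')" if "c \<in> layer i" for c
      using w(2) that unfolding delta_chain[OF finite_layer w(1)] by (simp add: res_def)
    then show "\<exists>w. (\<forall>c\<in>layer (Suc i). w c \<in> ?R) \<and> (\<forall>c\<in>layer i. z c = (\<Sum>c'\<in>layer (Suc i). delta (unit_cell c') c * w c'))"
      using chainsD(1)[OF w(1)] by blast
  next
    assume "\<exists>w. (\<forall>c\<in>layer (Suc i). w c \<in> ?R) \<and> (\<forall>c\<in>layer i. z c = (\<Sum>c'\<in>layer (Suc i). delta (unit_cell c') c * w c'))"
    then obtain w where w: "\<forall>c\<in>layer (Suc i). w c \<in> ?R"
      "\<forall>c\<in>layer i. z c = (\<Sum>c'\<in>layer (Suc i). delta (unit_cell c') c * w c')" by blast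
    have "\<forall>c\<in>layer i. delta (res (layer (Suc i)) w) c = res (layer i) z c"
      using w(2) by (simp add: d[OF w(1)] res_def)
    then show "\<exists>w\<in>chains (layer (Suc i)). \<forall>c\<in>layer i. delta w c = res (layer i) z c"
      using resR[OF w(1)] by blast
  qed
  show ?thesis
  proof (rule has_linear_resolutionI[where Z = layer and d = "1 + card P"
        and \<gamma> = "\<lambda>c. aug (res XI (delta (unit_cell c)))" and \<alpha> = "\<lambda>c c'. delta (unit_cell c') c"])
    show "finite (layer i)" for i by (rule finite_layer)
    show "aug (res XI (delta (unit_cell c))) \<in> ?R \<and> homog (1 + card P) (aug (res XI (delta (unit_cell c))))" for c
      using augR augH by blast
    show "delta (unit_cell c') c \<in> ?R \<and> homog 1 (delta (unit_cell c') c)" for c c'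
      using delta_in_R unitR deltaH by blast
    show "H_ideal I \<inter> H_ideal J = {\<Sum>c\<in>layer 0. z c * aug (res XI (delta (unit_cell c))) |z. \<forall>c\<in>layer 0. z c \<in> ?R}"
      unfolding HI HJ layer_image
    proof (intro equalityI subsetI)
      fix f assume "f \<in> (\<lambda>z. aug (res XI (delta z))) ` chains (layer 0)"
      then obtain z where z: "z \<in> chains (layer 0)" "f = aug (res XI (delta z))" by blast
      then show "f \<in> {\<Sum>c\<in>layer 0. z c * aug (res XI (delta (unit_cell c))) |z. \<forall>c\<in>layer 0. z c \<in> ?R}"
        using aug_delta_chain[OF finite_layer z(1)] chainsD(1)[OF z(1)] by blast
    next
      fix f assume "f \<in> {\<Sum>c\<in>layer 0. z c * aug (res XI (delta (unit_cell c))) |z. \<forall>c\<in>layer 0. z c \<in> ?R}"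
      then obtain z where z: "\<forall>c\<in>layer 0. z c \<in> ?R"
        "f = (\<Sum>c\<in>layer 0. z c * aug (res XI (delta (unit_cell c))))" by blast
      have "f = aug (res XI (delta (res (layer 0) z)))"
        unfolding z(2) a[OF z(1)] ..
      then show "f \<in> (\<lambda>z. aug (res XI (delta z))) ` chains (layer 0)"
        using resR[OF z(1)] by (rule image_eqI)
    qed
    show "(\<Sum>c\<in>layer 0. z c * aug (res XI (delta (unit_cell c)))) = 0 \<longleftrightarrow>
       (\<exists>w. (\<forall>c\<in>layer 1. w c \<in> ?R) \<and> (\<forall>c\<in>layer 0. z c = (\<Sum>c'\<in>layer 1. delta (unit_cell c') c * w c')))"
      if z: "\<forall>c\<in>layer 0. z c \<in> ?R" for z
      using layer_exact_0[OF resR[OF z]] ex[of 0 z] unfolding a[OF z] One_nat_def by (rule trans)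
    show "(\<forall>c\<in>layer i. (\<Sum>c'\<in>layer (Suc i). delta (unit_cell c') c * z c') = 0) \<longleftrightarrow>
       (\<exists>w. (\<forall>c\<in>layer (Suc (Suc i)). w c \<in> ?R) \<and>
          (\<forall>c\<in>layer (Suc i). z c = (\<Sum>c'\<in>layer (Suc (Suc i)). delta (unit_cell c') c * w c')))"
      if z: "\<forall>c\<in>layer (Suc i). z c \<in> ?R" for i z
      using layer_exact_Suc[OF resR[OF z]] ex[of "Suc i" z] unfolding d[OF z] by (rule trans)
  qed
qed

end
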